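(* Assume that $\operatorname{rank}(\partial\phi(\theta))$ is constant on $\Omega$ and that $$[\chi_1,\chi_2](\theta)\in W_\phi(\theta)\quad\text{for all }\chi_1,\chi_2\in W_\phi\text{ and all }\theta\in\Omega .$$ If $\theta(t)\in\mathbb{R}^D$ satisfies the gradient flow of the training cost $$\dot\theta(t)=-\nabla\mathcal{E}_{X,Y}(\theta(t)),\qquad \theta(0)=\theta_{\rm init},$$ where $\theta_{\rm init}\in\Omega$, then there is $0<T^\star_{\theta_{\rm init}}\le T_{\theta_{\rm init}}$ such that $z(t):=\phi(\theta(t))\in\mathbb{R}^d$ satisfies the ODE $$\dot z(t)=-M(z(t),\theta_{\rm init})\,\nabla f(z(t))\quad\text{for all }t\in[0,T^\star_{\theta_{\rm init}}),\qquad z(0)=\phi(\theta_{\rm init}),$$ where $M(z(t),\theta_{\rm init})\in\mathbb{R}^{d\times d}$ is a symmetric positive semi-definite matrix (depending, as the notation indicates, on $z(t)$ and $\theta_{\rm init}$).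
   Context: $\Theta\subseteq\mathbb{R}^D$ is an open set of parameters, $\Omega\subseteq\Theta$ is open, and $g(\theta,\cdot):\mathbb{R}^m\to\mathbb{R}^n$ is a parametric model. Given a data set $X=(x_i)_i$, $Y=(y_i)_i$ and a loss $\ell(z,y)$ that is $\mathcal{C}^2$ in $z$, the training cost is $\mathcal{E}_{X,Y}(\theta)=\sum_i\ell(g(\theta,x_i),y_i)$; the data set is such that each $g(\cdot,x_i)$ is $\mathcal{C}^2$ on $\Omega$. $[0,T_{\theta_{\rm init}})$ is the interval of existence of the maximal solution of the gradient flow started at $\theta_{\rm init}$. The map $\phi=(\phi_1,\dots,\phi_d)\in\mathcal{C}^\infty(\Theta,\mathbb{R}^d)$ is a reparametrization of the model: near each parameter $\theta_0\in\Omega$, and for each data point $x_i$, one has $g(\theta,x_i)=\tilde f(\phi(\theta),x_i)$ for some $\mathcal{C}^2$ function $\tilde f(\cdot,x_i)$. Consequently the cost factors near $\theta_{\rm init}$ as $\mathcal{E}_{X,Y}=f\circ\phi$ with $f(z)=\sum_i\ell(\tilde f(z,x_i),y_i)$; this is the function $f$ in the claim. $\partial\phi(\theta)\in\mathbb{R}^{d\times D}$ is the Jacobian of $\phi$. $W_\phi=\operatorname{span}\{\nabla\phi_1,\dots,\nabla\phi_d\}$ is the finite-dimensional space of vector fields spanned by the gradients of the coordinates of $\phi$, and $W_\phi(\theta)=\operatorname{span}\{\chi(\theta):\chi\in W_\phi\}=\operatorname{range}(\partial\phi(\theta)^\top)$. The Lie bracket of vector fields is $[\chi_1,\chi_2](\theta)=\partial\chi_1(\theta)\chi_2(\theta)-\partial\chi_2(\theta)\chi_1(\theta)$,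 with $\partial\chi$ the Jacobian of $\chi$. *)

theory Defs
  imports "HOL-Analysis.Analysis"
begin

text \<open>Meant for open \<open>S\<close>. In finite dimension, continuity of all iterated directional
  derivatives up to order \<open>k\<close> is the usual \<open>C\<^sup>k\<close> condition.\<close>

primrec Ck_on :: "nat \<Rightarrow> 'a::euclidean_space set \<Rightarrow> ('a \<Rightarrow> 'b::real_normed_vector) \<Rightarrow> bool" where
  "Ck_on 0 S f \<longleftrightarrow> continuous_on S f"
| "Ck_on (Suc k) S f \<longleftrightarrow>
     (\<forall>x\<in>S. f differentiable (at x)) \<and>
     (\<forall>v. Ck_on k S (\<lambda>x. frechet_derivative f (at x) v))"

definition smooth_on :: "'a::euclidean_space set \<Rightarrow> ('a \<Rightarrow> 'b::real_normed_vector) \<Rightarrow> bool" where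
  "smooth_on S f \<longleftrightarrow> (\<forall>k. Ck_on k S f)"

definition gradient :: "('a::euclidean_space \<Rightarrow> real) \<Rightarrow> 'a \<Rightarrow> 'a" where
  "gradient f x = (THE D. GDERIV f x :> D)"

definition gradient_fields :: "(real^'D \<Rightarrow> real^'d) \<Rightarrow> (real^'D \<Rightarrow> real^'D) set" where
  "gradient_fields \<phi> =
     range (\<lambda>c :: real^'d. \<lambda>\<theta>. \<Sum>j\<in>UNIV. c $ j *\<^sub>R gradient (\<lambda>\<eta>. \<phi> \<eta> $ j) \<theta>)"

definition gradient_fields_at :: "(real^'D \<Rightarrow> real^'d) \<Rightarrow> real^'D \<Rightarrow> (real^'D) set" where
  "gradient_fields_at \<phi> \<theta> = span ((\<lambda>\<xi>. \<xi> \<theta>) ` gradient_fields \<phi>)"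

text \<open>The sign convention is opposite to that of the commutator of derivations.\<close>

definition lie_bracket ::
    "(real^'D \<Rightarrow> real^'D) \<Rightarrow> (real^'D \<Rightarrow> real^'D) \<Rightarrow> real^'D \<Rightarrow> real^'D" where
  "lie_bracket \<chi>1 \<chi>2 \<theta> = jacobian \<chi>1 (at \<theta>) *v \<chi>2 \<theta> - jacobian \<chi>2 (at \<theta>) *v \<chi>1 \<theta>"

definition sym_psd :: "real^'d^'d \<Rightarrow> bool" where
  "sym_psd A \<longleftrightarrow> transpose A = A \<and> (\<forall>v. 0 \<le> v \<bullet> (A *v v))"

text \<open>With \<open>h\<close> the model this is the training cost as a function of the parameter; with \<open>h\<close> a
  factor of the model through the reparametrization it is the factor of the training cost.\<close>

definition data_cost ::
    "('n \<Rightarrow> 'y \<Rightarrow> real) \<Rightarrow> ('p \<Rightarrow> 'x \<Rightarrow> 'n) \<Rightarrow> nat \<Rightarrow> (nat \<Rightarrow> 'x) \<Rightarrow> (nat \<Rightarrow> 'y) \<Rightarrow> 'p \<Rightarrow> real" where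
  "data_cost l h N X Y p = (\<Sum>i<N. l (h p (X i)) (Y i))"

text \<open>\<open>V\<close> is an open set on which the factor is \<open>C\<^sup>2\<close>; it has to contain \<open>\<phi> ` U\<close>, which itself
  need not be open.\<close>

definition factors_locally ::
    "(real^'D) set \<Rightarrow> (real^'D \<Rightarrow> real^'d) \<Rightarrow> (real^'D \<Rightarrow> real^'m \<Rightarrow> real^'n) \<Rightarrow> (real^'m) set \<Rightarrow>
     real^'D \<Rightarrow> (real^'D) set \<Rightarrow> (real^'d) set \<Rightarrow> (real^'d \<Rightarrow> real^'m \<Rightarrow> real^'n) \<Rightarrow> bool" where
  "factors_locally \<Omega> \<phi> g P \<theta>\<^sub>0 U V ft \<longleftrightarrow>
     open U \<and> \<theta>\<^sub>0 \<in> U \<and> U \<subseteq> \<Omega> \<and> open V \<and> \<phi> ` U \<subseteq> V \<and>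
     (\<forall>x\<in>P. Ck_on 2 V (\<lambda>z. ft z x) \<and> (\<forall>\<theta>\<in>U. g \<theta> x = ft (\<phi> \<theta>) x))"

definition reparametrizes ::
    "(real^'D) set \<Rightarrow> (real^'D \<Rightarrow> real^'d) \<Rightarrow> (real^'D \<Rightarrow> real^'m \<Rightarrow> real^'n) \<Rightarrow> (real^'m) set \<Rightarrow> bool" where
  "reparametrizes \<Omega> \<phi> g P \<longleftrightarrow>
     (\<forall>\<theta>\<^sub>0\<in>\<Omega>. \<forall>x\<in>P. \<exists>U V ft. factors_locally \<Omega> \<phi> g {x} \<theta>\<^sub>0 U V ft)"

text \<open>Autonomous initial value problem on \<open>[0, T)\<close>, where \<open>T = \<infinity>\<close> is allowed, with phase
  space \<open>S\<close>; the derivative at \<open>0\<close> is one-sided.\<close>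

definition ivp_solution ::
    "'a::real_normed_vector set \<Rightarrow> ('a \<Rightarrow> 'a) \<Rightarrow> 'a \<Rightarrow> ereal \<Rightarrow> (real \<Rightarrow> 'a) \<Rightarrow> bool" where
  "ivp_solution S F u\<^sub>0 T u \<longleftrightarrow>
     0 < T \<and> u 0 = u\<^sub>0 \<and>
     (\<forall>t. 0 \<le> t \<and> ereal t < T \<longrightarrow>
        u t \<in> S \<and>
        (u has_vector_derivative F (u t)) (at t within {s. 0 \<le> s \<and> ereal s < T}))"

definition maximal_ivp_solution ::
    "'a::real_normed_vector set \<Rightarrow> ('a \<Rightarrow> 'a) \<Rightarrow> 'a \<Rightarrow> ereal \<Rightarrow> (real \<Rightarrow> 'a) \<Rightarrow> bool" where
  "maximal_ivp_solution S F u\<^sub>0 T u \<longleftrightarrow>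
     ivp_solution S F u\<^sub>0 T u \<and>
     (\<forall>T' v. ivp_solution S F u\<^sub>0 T' v \<and> (\<forall>t. 0 \<le> t \<and> ereal t < T \<longrightarrow> v t = u t) \<longrightarrow> T' \<le> T)"

end

theory Submission
  imports Defs
begin

text \<open>Every gradient flow started at \<open>\<theta>\<^sub>0\<close> is tangent to the distribution
  \<open>W\<^sub>\<phi>(\<theta>) = range (\<partial>\<phi>(\<theta>)\<^sup>T)\<close>, and \<open>d/dt \<phi>(\<theta>(t)) = - \<partial>\<phi> \<partial>\<phi>\<^sup>T \<nabla>f\<close>. It therefore
  suffices to recover \<open>\<theta>(t)\<close> from \<open>\<phi>(\<theta>(t))\<close> and \<open>\<theta>\<^sub>0\<close>, independently of the flow. Since \<open>W\<^sub>\<phi>\<close> is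
  involutive of constant rank, it is spanned near \<open>\<theta>\<^sub>0\<close> by fields \<open>A(\<theta>) v\<close>, linear in \<open>v\<close>, that
  commute and project to the constants \<open>P v\<close> under \<open>P \<circ> \<partial>\<phi>(\<theta>)\<close>, with \<open>P\<close> a projection onto the
  range of \<open>\<partial>\<phi>(\<theta>\<^sub>0)\<close>. Flowing along them from \<open>\<theta>\<^sub>0\<close> gives a map \<open>F\<close> with \<open>DF = A \<circ> F\<close>. By
  uniqueness for ordinary differential equations every curve tangent to \<open>W\<^sub>\<phi>\<close> from \<open>\<theta>\<^sub>0\<close>
  satisfies \<open>\<theta>(t) = F (P (\<phi>(\<theta>(t)) - \<phi>(\<theta>\<^sub>0)))\<close> for small \<open>t\<close>.\<close>

subsection \<open>Integral maps of flat fields\<close>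

text \<open>At a point \<open>s\<close> where \<open>norm (q t)\<close> is largest, the mean value
  inequality bounds the maximum by \<open>\<tau> * (m * norm (q s) + e)\<close>; since
  \<open>\<tau> * m\<close> is at most 1/2, half of the maximum is absorbed on the left. On short
  intervals this replaces the exponential bound, and \<open>e = 0\<close> yields uniqueness.\<close>

lemma small_gronwall:
  fixes q :: "real \<Rightarrow> 'a::real_normed_vector"
  assumes \<tau>: "0 \<le> \<tau>" and q0: "q 0 = 0"
    and der: "\<And>t. t \<in> {0..\<tau>} \<Longrightarrow> (q has_vector_derivative q' t) (at t within {0..\<tau>})"
    and bd: "\<And>t. t \<in> {0..\<tau>} \<Longrightarrow> norm (q' t) \<le> m * norm (q t) + e"
    and m: "0 \<le> m" "\<tau> * m \<le> 1 / 2" and t: "t \<in> {0..\<tau>}"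
  shows "norm (q t) \<le> 2 * \<tau> * e"
proof -
  have "continuous_on {0..\<tau>} q"
    using der has_vector_derivative_continuous continuous_on_eq_continuous_within by blast
  then have "continuous_on {0..\<tau>} (\<lambda>t. norm (q t))"
    by (intro continuous_intros)
  then obtain s where s: "s \<in> {0..\<tau>}" and max: "\<And>t. t \<in> {0..\<tau>} \<Longrightarrow> norm (q t) \<le> norm (q s)"
    using continuous_attains_sup[of "{0..\<tau>}" "\<lambda>t. norm (q t)"] \<tau> by auto
  have "norm (q s - q 0) \<le> (m * norm (q s) + e) * norm (s - 0)"
  proof (rule differentiable_bound[where S = "{0..\<tau>}" and f' = "\<lambda>t h. h *\<^sub>R q' t"])
    fix x assume x: "x \<in> {0..\<tau>}"
    show "(q has_derivative (\<lambda>h. h *\<^sub>R q' x)) (at x within {0..\<tau>})"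
      using der[OF x] by (simp add: has_vector_derivative_def)
    have "norm (q' x) \<le> m * norm (q s) + e"
      using bd[OF x] mult_left_mono[OF max[OF x] m(1)] by linarith
    then show "onorm (\<lambda>h. h *\<^sub>R q' x) \<le> m * norm (q s) + e"
      by (intro onorm_le) (simp add: mult.commute mult_left_mono)
  qed (use der s \<tau> in auto)
  then have 1: "norm (q s) \<le> (m * norm (q s) + e) * s"
    using s q0 by simp
  have nn: "0 \<le> m * norm (q s) + e"
    using bd[OF s] norm_ge_zero order_trans by blast
  have "norm (q s) \<le> (m * norm (q s) + e) * \<tau>"
    using 1 mult_left_mono[OF _ nn, of s \<tau>] s by auto
  also have "\<dots> = (\<tau> * m) * norm (q s) + \<tau> * e"
    by (simp add: algebra_simps)
  also have "\<dots> \<le> 1 / 2 * norm (q s) + \<tau> * e"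
    using m(2) by (intro add_right_mono mult_right_mono) auto
  finally show ?thesis
    using max[OF t] by simp
qed

text \<open>Contraction principle for the integral equation. The time interval has length 1 and the
  smallness sits in \<open>G\<close>: its bound keeps curves in the ball, and the Lipschitz constant
  1/2 makes the integral operator contract. This suits fields linear in a parameter, where shrinking
  the parameter amounts to rescaling time.\<close>

lemma picard_unit_interval:
  fixes G :: "'a::euclidean_space \<Rightarrow> 'a"
  assumes G: "\<And>x. x \<in> cball x0 \<rho> \<Longrightarrow> norm (G x) \<le> \<rho>"
    and lip: "\<And>x y. \<lbrakk>x \<in> cball x0 \<rho>; y \<in> cball x0 \<rho>\<rbrakk> \<Longrightarrow> norm (G x - G y) \<le> norm (x - y) / 2"
    and "0 \<le> \<rho>"
  shows "\<exists>u. u 0 = x0 \<and> (\<forall>t\<in>{0..1}. u t \<in> cball x0 \<rho> \<and>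
           (u has_vector_derivative G (u t)) (at t within {0..1}))"
proof -
  \<comment> \<open>Bounded continuous curves on the whole line with values in the ball form a
    complete space; the solution is the restriction of one of them to \<open>{0..1}\<close>.\<close>
  define S where "S = PiC (UNIV :: real set) (\<lambda>_. cball x0 \<rho>)"
  define I where "I u t =  x0 + integral {0..t} (\<lambda>s. G (u s))" for u :: "real \<Rightarrow>\<^sub>C 'a" and t
  have contG: "continuous_on (cball x0 \<rho>) G"
  proof (rule continuous_onI)
    fix x e assume "x \<in> cball x0 \<rho>" "(0::real) < e"
    then show "\<exists>d>0. \<forall>x'\<in>cball x0 \<rho>. dist x' x < d \<longrightarrow> dist (G x') (G x) \<le> e"
      using lip by (intro exI[of _ e]) (force simp: dist_norm)
  qed
  have memS: "u t \<in> cball x0 \<rho>" if "u \<in> S" for u t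
    using that unfolding S_def mem_PiC_iff by blast
  have contGu: "continuous_on {0..b} (\<lambda>s. G (apply_bcontfun u s))" if "u \<in> S" for u b
    by (rule continuous_on_compose2[OF contG]) (use memS[OF that] in auto)
  have derI: "(I u has_vector_derivative G (u t)) (at t within {0..1})"
    if "u \<in> S" "t \<in> {0..1}" for u t
    unfolding I_def using integral_has_vector_derivative[OF contGu[OF that(1)] that(2)]
    by (auto intro!: derivative_eq_intros)
  \<comment> \<open>Clamping time to \<open>{0..1}\<close> extends the integral curve to a bounded
    continuous function on the line, so the integral operator acts within the function
    space.\<close>
  have "\<exists>w :: real \<Rightarrow>\<^sub>C 'a. \<forall>s. w s = I u (clamp 0 1 s)" if "u \<in> S" for u
  proof -
    have "continuous_on {0..1} (I u)"
      using derI[OF that] has_vector_derivative_continuous continuous_on_eq_continuous_within by blast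
    then show ?thesis
      using continuous_on_cbox_bcontfunE[of 0 1 "I u"] by (metis cbox_interval)
  qed
  then obtain P :: "(real \<Rightarrow>\<^sub>C 'a) \<Rightarrow> (real \<Rightarrow>\<^sub>C 'a)"
    where P: "\<And>u s. u \<in> S \<Longrightarrow> P u s = I u (clamp 0 1 s)"
    by metis
  have cl: "clamp 0 1 s \<in> {0..1}" for s :: real
    using clamp_in_interval[of 0 1 s] by simp
  have bound: "norm (integral {0..t} f) \<le> B"
    if "t \<in> {0..1}" "continuous_on {0..t} f" "\<And>s. s \<in> {0..t} \<Longrightarrow> norm (f s) \<le> B" "0 \<le> B"
    for t B and f :: "real \<Rightarrow> 'a"
  proof -
    have "norm (integral {0..t} f) \<le> B * (t - 0)"
      using that by (intro integral_bound) auto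
    also have "\<dots> \<le> B"
      using that by (simp add: mult_left_le)
    finally show ?thesis .
  qed
  have "\<exists>!u\<in>S. P u = u"
  proof (rule Banach_fix[of S "1/2" P])
    show "complete S"
      unfolding S_def by (simp add: closed_PiC complete_eq_closed)
    have "const_bcontfun x0 \<in> S"
      using \<open>0 \<le> \<rho>\<close> unfolding S_def mem_PiC_iff by (simp add: const_bcontfun.rep_eq)
    then show "S \<noteq> {}" by blast
    show "P ` S \<subseteq> S"
    proof
      fix w assume "w \<in> P ` S"
      then obtain u where u: "u \<in> S" "w = P u" by blast
      have "norm (integral {0..t} (\<lambda>s. G (u s))) \<le> \<rho>" if "t \<in> {0..1}" for t
        using that contGu[OF u(1)] G memS[OF u(1)] \<open>0 \<le> \<rho>\<close> by (intro bound) auto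
      then have "w s \<in> cball x0 \<rho>" for s
        using cl unfolding u(2) P[OF u(1)] I_def by (simp add: dist_norm)
      then show "w \<in> S"
        unfolding S_def mem_PiC_iff by blast
    qed
    fix u v assume u: "u \<in> S" and v: "v \<in> S"
    have "dist (P u s) (P v s) \<le> dist u v / 2" for s
    proof -
      let ?t = "clamp 0 1 s"
      have "P u s - P v s = integral {0..?t} (\<lambda>s. G (u s) - G (v s))"
        using u v contGu by (simp add: P I_def integral_diff integrable_continuous_real)
      also have "norm \<dots> \<le> dist u v / 2"
      proof (rule bound)
        fix s
        have "norm (G (u s) - G (v s)) \<le> norm (u s - v s) / 2"
          by (rule lip) (use memS u v in auto)
        also have "\<dots> \<le> dist u v / 2"
          using dist_bounded[of u s v] by (simp add: dist_norm)
        finally show "norm (G (u s) - G (v s)) \<le> dist u v / 2" .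
      qed (use cl u v contGu in \<open>auto intro!: continuous_intros\<close>)
      finally show ?thesis by (simp add: dist_norm)
    qed
    then show "dist (P u) (P v) \<le> 1 / 2 * dist u v"
      using dist_bound[of "P u" "P v" "dist u v / 2"] by simp
  qed auto
  then obtain u where u: "u \<in> S" "P u = u" by blast
  have ueq: "u t = I u t" if "t \<in> {0..1}" for t
    using P[OF u(1), of t] u(2) that by simp
  have "(u has_vector_derivative G (u t)) (at t within {0..1})" if "t \<in> {0..1}" for t
    by (rule has_vector_derivative_transform[OF that _ derI[OF u(1) that]]) (simp add: ueq)
  then show ?thesis
    using memS[OF u(1)] ueq[of 0] by (intro exI[of _ "apply_bcontfun u"]) (auto simp: I_def)
qed

text \<open>Compactness makes \<open>A'\<close> uniformly continuous, so one \<open>d\<close> serves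
  all base points; convexity keeps the segment from \<open>x\<close> to \<open>y\<close> in
  \<open>K\<close>, where the mean value inequality applies to \<open>A\<close> minus its linear
  part at \<open>x\<close>.\<close>

lemma uniform_linearization:
  fixes A :: "'x::euclidean_space \<Rightarrow> 'z::real_normed_vector" and A' :: "'x \<Rightarrow> 'x \<Rightarrow>\<^sub>L 'z"
  assumes K: "compact K" "convex K"
    and der: "\<And>x. x \<in> K \<Longrightarrow> (A has_derivative A' x) (at x)"
    and cont: "continuous_on K A'" and e: "0 < e"
  shows "\<exists>d>0. \<forall>x\<in>K. \<forall>y\<in>K. dist x y < d \<longrightarrow> norm (A y - A x - A' x (y - x)) \<le> e * norm (y - x)"
proof -
  have "uniformly_continuous_on K A'"
    using compact_uniformly_continuous K cont by blast
  then obtain d where d: "d > 0"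
    and d': "\<And>x y. \<lbrakk>x \<in> K; y \<in> K; dist y x < d\<rbrakk> \<Longrightarrow> dist (A' y) (A' x) < e"
    using e unfolding uniformly_continuous_on_def by metis
  have "norm (A y - A x - A' x (y - x)) \<le> e * norm (y - x)"
    if xy: "x \<in> K" "y \<in> K" "dist x y < d" for x y
  proof -
    have sub: "closed_segment x y \<subseteq> K"
      using closed_segment_subset K xy by blast
    have "norm (A y - A x - A' x (y - x)) \<le> norm (y - x) * e"
    proof (rule differentiable_bound_linearization[where S = "closed_segment x y"
          and f' = "\<lambda>x. blinfun_apply (A' x)"])
      fix t :: real assume "t \<in> {0..1}"
      then show "x + t *\<^sub>R (y - x) \<in> closed_segment x y"
        unfolding closed_segment_def by (auto intro!: exI[of _ t] simp: algebra_simps)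
    next
      fix z assume z: "z \<in> closed_segment x y"
      show "(A has_derivative A' z) (at z within closed_segment x y)"
        using der sub z by (blast intro: has_derivative_at_withinI)
      have "dist z x < d"
        using dist_in_closed_segment[OF z] xy(3) by (simp add: dist_commute)
      then have "norm (A' z - A' x) \<le> e"
        using d'[of x z] xy z sub by (fastforce simp: dist_norm)
      then show "onorm (blinfun_apply (A' z) - blinfun_apply (A' x)) \<le> e"
        by (simp add: norm_blinfun.rep_eq minus_blinfun.rep_eq fun_diff_def)
    qed simp
    then show ?thesis by (simp add: mult.commute)
  qed
  then show ?thesis using d by blast
qed

text \<open>Compactness of a closed ball bounds \<open>A\<close> and \<open>A'\<close>, and
  convexity of the ball turns the bound on \<open>A'\<close> into a Lipschitz constant.\<close>

lemma C1_local_bounds: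
  fixes A :: "'x::euclidean_space \<Rightarrow> 'z::real_normed_vector" and A' :: "'x \<Rightarrow> 'x \<Rightarrow>\<^sub>L 'z"
  assumes B: "open B" "x0 \<in> B"
    and derB: "\<forall>x\<in>B. (A has_derivative A' x) (at x)"
    and cont: "continuous_on B A'"
  shows "\<exists>\<rho> K L. 0 < \<rho> \<and> 0 \<le> K \<and> 0 \<le> L \<and> cball x0 \<rho> \<subseteq> B \<and>
    (\<forall>x\<in>cball x0 \<rho>. norm (A x) \<le> K \<and> norm (A' x) \<le> L \<and>
       (\<forall>y\<in>cball x0 \<rho>. norm (A x - A y) \<le> L * norm (x - y)))"
proof -
  have der: "(A has_derivative A' x) (at x)" if "x \<in> B" for x
    using derB that by blast
  obtain \<rho> where \<rho>: "0 < \<rho>" "cball x0 \<rho> \<subseteq> B"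
    using B open_contains_cball by blast
  have "continuous_on (cball x0 \<rho>) A'"
    using cont \<rho>(2) continuous_on_subset by blast
  then have "bounded (A' ` cball x0 \<rho>)"
    using compact_cball compact_continuous_image compact_imp_bounded by blast
  then obtain L where L: "\<And>x. x \<in> cball x0 \<rho> \<Longrightarrow> norm (A' x) \<le> L"
    unfolding bounded_iff by blast
  have "continuous_on (cball x0 \<rho>) A"
    using der \<rho>(2) by (meson continuous_at_imp_continuous_on has_derivative_continuous subsetD)
  then have "bounded (A ` cball x0 \<rho>)"
    using compact_cball compact_continuous_image compact_imp_bounded by blast
  then obtain K where K: "\<And>x. x \<in> cball x0 \<rho> \<Longrightarrow> norm (A x) \<le> K"
    unfolding bounded_iff by blast
  have x0: "x0 \<in> cball x0 \<rho>"
    using \<rho>(1) by simp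
  have "norm (A x - A y) \<le> L * norm (x - y)" if "x \<in> cball x0 \<rho>" "y \<in> cball x0 \<rho>" for x y
    by (rule differentiable_bound[where S = "cball x0 \<rho>" and f' = "\<lambda>x. blinfun_apply (A' x)"])
      (use \<rho>(2) has_derivative_at_withinI[OF der] L that
        in \<open>auto simp: norm_blinfun.rep_eq[symmetric] subset_iff\<close>)
  moreover have "0 \<le> K" "0 \<le> L"
    using K[OF x0] L[OF x0] norm_ge_zero order_trans by blast+
  ultimately show ?thesis
    using \<rho> K L by blast
qed

lemma has_vector_derivative_blinfun_compose:
  fixes A' :: "'x::real_normed_vector \<Rightarrow>\<^sub>L 'z::real_normed_vector"
  assumes "(u has_vector_derivative u') (at t within S)" "(A has_derivative A') (at (u t))"
  shows "((\<lambda>t. A (u t)) has_vector_derivative A' u') (at t within S)"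
  using has_derivative_compose[OF assms(1)[unfolded has_vector_derivative_def] assms(2)]
  by (simp add: has_vector_derivative_def blinfun.scaleR_right)

text \<open>Let \<open>u\<^sub>y\<close> solve \<open>u' = A u y\<close> with \<open>u 0 = x0\<close>, and put \<open>F y = u\<^sub>y 1\<close>. With \<open>u = u\<^sub>y\<close> and
  \<open>w = u\<^bsub>y+k\<^esub>\<close>, flatness makes \<open>q s = w s - u s - s A (u s) k\<close> satisfy
  \<open>q' = A' u q y + o(k)\<close>, so that \<open>q 1 = F (y + k) - F y - A (F y) k\<close> is \<open>o(k)\<close>.\<close>

lemma flat_field_integral_map:
  fixes A :: "'x::euclidean_space \<Rightarrow> ('y::euclidean_space \<Rightarrow>\<^sub>L 'x)"
    and A' :: "'x \<Rightarrow> ('x \<Rightarrow>\<^sub>L ('y \<Rightarrow>\<^sub>L 'x))"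
  assumes B: "open B" "x0 \<in> B"
    and der: "\<And>x. x \<in> B \<Longrightarrow> (A has_derivative A' x) (at x)"
    and cont: "continuous_on B A'"
    and flat: "\<And>x v k. x \<in> B \<Longrightarrow> A' x (A x v) k = A' x (A x k) v"
  obtains r F where "0 < r" "F 0 = x0" "\<And>y. y \<in> ball 0 r \<Longrightarrow> F y \<in> B"
    "\<And>y. y \<in> ball 0 r \<Longrightarrow> (F has_derivative A (F y)) (at y)"
proof -
  have derB: "\<forall>x\<in>B. (A has_derivative A' x) (at x)"
    using der by blast
  obtain \<rho> K L where \<rho>: "0 < \<rho>" and KL0: "0 \<le> K" "0 \<le> L" and sub: "cball x0 \<rho> \<subseteq> B"
    and K: "\<And>x. x \<in> cball x0 \<rho> \<Longrightarrow> norm (A x) \<le> K"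
    and L: "\<And>x. x \<in> cball x0 \<rho> \<Longrightarrow> norm (A' x) \<le> L"
    and lip: "\<And>x y. \<lbrakk>x \<in> cball x0 \<rho>; y \<in> cball x0 \<rho>\<rbrakk> \<Longrightarrow> norm (A x - A y) \<le> L * norm (x - y)"
    using C1_local_bounds[OF B derB cont] by blast
  \<comment> \<open>For \<open>norm y < r\<close> the field given by \<open>A x y\<close> is bounded
    by \<open>\<rho>\<close> and 1/2-Lipschitz on the ball, as the Picard lemma asks. The summands 1
    prevent division by zero.\<close>
  define r where "r = min (\<rho> / (K + 1)) (1 / (2 * (L + 1)))"
  have r: "0 < r" using \<rho> KL0 by (simp add: r_def)
  have rK: "r * K \<le> \<rho>"
  proof -
    have "r * K \<le> \<rho> / (K + 1) * K"
      using KL0 by (intro mult_right_mono) (simp_all add: r_def)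
    also have "\<dots> \<le> \<rho>"
      using \<rho> KL0 by (simp add: field_simps)
    finally show ?thesis .
  qed
  have rL: "r * L \<le> 1 / 2"
  proof -
    have "r * L \<le> 1 / (2 * (L + 1)) * L"
      using KL0 by (intro mult_right_mono) (simp_all add: r_def)
    also have "\<dots> \<le> 1 / 2"
      using KL0 by (simp add: field_simps)
    finally show ?thesis .
  qed
  have "\<exists>u. u 0 = x0 \<and> (\<forall>t\<in>{0..1}. u t \<in> cball x0 \<rho> \<and>
           (u has_vector_derivative A (u t) y) (at t within {0..1}))" if y: "y \<in> ball 0 r" for y
  proof (rule picard_unit_interval)
    have yr: "norm y \<le> r" using y by simp
    fix x assume x: "x \<in> cball x0 \<rho>"
    have "norm (A x y) \<le> K * r"
      using norm_blinfun[of "A x" y] mult_mono[OF K[OF x] yr KL0(1)] by fastforce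
    then show "norm (A x y) \<le> \<rho>"
      using rK by (simp add: mult.commute)
    fix z assume z: "z \<in> cball x0 \<rho>"
    have "norm (A x y - A z y) \<le> norm (A x - A z) * norm y"
      using norm_blinfun[of "A x - A z" y] by (simp add: blinfun.diff_left)
    also have "\<dots> \<le> (L * norm (x - z)) * r"
      using lip[OF x z] yr KL0 by (intro mult_mono) auto
    also have "\<dots> = (r * L) * norm (x - z)" by simp
    also have "\<dots> \<le> 1 / 2 * norm (x - z)"
      using rL by (intro mult_right_mono) auto
    finally show "norm (A x y - A z y) \<le> norm (x - z) / 2" by simp
  qed (use \<rho> in auto)
  then obtain u where u0: "\<And>y. y \<in> ball 0 r \<Longrightarrow> u y 0 = x0"
    and ub: "\<And>y t. \<lbrakk>y \<in> ball 0 r; t \<in> {0..1}\<rbrakk> \<Longrightarrow> u y t \<in> cball x0 \<rho>"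
    and ud: "\<And>y t. \<lbrakk>y \<in> ball 0 r; t \<in> {0..1}\<rbrakk> \<Longrightarrow>
               (u y has_vector_derivative A (u y t) y) (at t within {0..1})"
    by metis
  define F where "F y = u y 1" for y
  \<comment> \<open>Lipschitz dependence of the solution on \<open>y\<close>: the difference of two
    solutions obeys a linear inequality with inhomogeneity \<open>A (u (y + k) s) k\<close>, which
    is at most \<open>K * norm k\<close>.\<close>
  have dif: "norm (u (y + k) t - u y t) \<le> 2 * K * norm k"
    if y: "y \<in> ball 0 r" and yk: "y + k \<in> ball 0 r" and t: "t \<in> {0..1}" for y k t
  proof -
    have "norm (u (y + k) t - u y t) \<le> 2 * 1 * (K * norm k)"
    proof (rule small_gronwall[where m = "r * L" and \<tau> = 1
          and q' = "\<lambda>s. A (u (y + k) s) (y + k) - A (u y s) y"])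
      fix s :: real assume s: "s \<in> {0..1}"
      show "((\<lambda>s. u (y + k) s - u y s) has_vector_derivative
          A (u (y + k) s) (y + k) - A (u y s) y) (at s within {0..1})"
        using ud[OF y s] ud[OF yk s] by (intro has_vector_derivative_diff)
      have "norm ((A (u (y + k) s) - A (u y s)) y) \<le> norm (A (u (y + k) s) - A (u y s)) * norm y"
        by (rule norm_blinfun)
      also have "\<dots> \<le> (L * norm (u (y + k) s - u y s)) * r"
        using lip[OF ub[OF yk s] ub[OF y s]] y KL0 by (intro mult_mono) auto
      moreover have "norm (A (u (y + k) s) k) \<le> K * norm k"
        using norm_blinfun[of "A (u (y + k) s)" k] mult_right_mono[OF K[OF ub[OF yk s]], of "norm k"]
        by simp
      moreover have "A (u (y + k) s) (y + k) - A (u y s) y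
          = (A (u (y + k) s) - A (u y s)) y + A (u (y + k) s) k"
        by (simp add: blinfun.bilinear_simps)
      ultimately show "norm (A (u (y + k) s) (y + k) - A (u y s) y)
          \<le> r * L * norm (u (y + k) s - u y s) + K * norm k"
        by (smt (verit) norm_triangle_ineq mult.assoc mult.commute)
    qed (use u0 y yk t r KL0 rL in auto)
    then show ?thesis by simp
  qed
  have Fder: "(F has_derivative A (F y)) (at y)" if y: "y \<in> ball 0 r" for y
    unfolding has_derivative_at_alt
  proof (intro conjI allI impI)
    show "bounded_linear (blinfun_apply (A (F y)))"
      by (rule blinfun.bounded_linear_right)
    fix e :: real assume e: "0 < e"
    \<comment> \<open>Chosen so that the linearization error contributes at most
      \<open>e / 2\<close> to the final bound.\<close>
    define e1 where "e1 = e / (8 * (K + 1) * (r + 1))"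
    have e1: "0 < e1" using e KL0 r by (simp add: e1_def)
    have "\<exists>d>0. \<forall>x\<in>cball x0 \<rho>. \<forall>y\<in>cball x0 \<rho>. dist x y < d \<longrightarrow>
        norm (A y - A x - A' x (y - x)) \<le> e1 * norm (y - x)"
      by (rule uniform_linearization)
        (use sub der continuous_on_subset[OF cont sub] e1 in \<open>auto simp: subset_iff\<close>)
    then obtain d1 where d1: "0 < d1"
      and lin: "\<And>x y. \<lbrakk>x \<in> cball x0 \<rho>; y \<in> cball x0 \<rho>; dist x y < d1\<rbrakk> \<Longrightarrow>
                  norm (A y - A x - A' x (y - x)) \<le> e1 * norm (y - x)"
      by blast
    \<comment> \<open>The three entries keep \<open>y + k\<close> in the ball, keep the two
      solutions within \<open>d1\<close> of each other, and make the term quadratic in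
      \<open>k\<close> contribute at most \<open>e / 2\<close>.\<close>
    define d where "d = Min {r - norm y, d1 / (2 * (K + 1)), e / (8 * (L + 1) * (K + 1))}"
    have d: "0 < d" "d \<le> r - norm y" "d \<le> d1 / (2 * (K + 1))" "d \<le> e / (8 * (L + 1) * (K + 1))"
      using y d1 e KL0 by (auto simp: d_def)
    have main: "norm (F (y + k) - F y - A (F y) k) \<le> e * norm k" if k: "norm k < d" for k
    proof -
      have yk: "y + k \<in> ball 0 r"
        using k d(2) norm_triangle_ineq[of y k] by simp
      let ?u = "u y" and ?w = "u (y + k)"
      have close: "dist (?u s) (?w s) < d1" if "s \<in> {0..1}" for s
      proof -
        have "dist (?u s) (?w s) \<le> 2 * K * norm k"
          using dif[OF y yk that] by (simp add: dist_norm norm_minus_commute)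
        also have "\<dots> \<le> 2 * (K + 1) * norm k"
          by (intro mult_right_mono) auto
        also have "\<dots> < 2 * (K + 1) * d"
          using k KL0 by (intro mult_strict_left_mono) auto
        also have "\<dots> \<le> d1"
          using d(3) KL0 by (simp add: field_simps)
        finally show ?thesis .
      qed
      define err where "err = e1 * (2 * K * norm k) * r + L * (2 * K * norm k) * norm k"
      have "norm (?w 1 - ?u 1 - 1 *\<^sub>R A (?u 1) k) \<le> 2 * 1 * err"
      proof (rule small_gronwall[where m = "r * L" and \<tau> = 1 and q = "\<lambda>s. ?w s - ?u s - s *\<^sub>R A (?u s) k"
            and q' = "\<lambda>s. A (?w s) (y + k) - A (?u s) y - (s *\<^sub>R A' (?u s) (A (?u s) y) k + A (?u s) k)"])
        fix s :: real assume s: "s \<in> {0..1}"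
        have us: "?u s \<in> cball x0 \<rho>" and ws: "?w s \<in> cball x0 \<rho>"
          using ub s y yk by auto
        have "((\<lambda>s. A (?u s)) has_vector_derivative A' (?u s) (A (?u s) y)) (at s within {0..1})"
          by (rule has_vector_derivative_blinfun_compose[OF ud[OF y s]]) (use der sub us in auto)
        then have "((\<lambda>s. A (?u s) k) has_vector_derivative A' (?u s) (A (?u s) y) k) (at s within {0..1})"
          by (rule bounded_linear.has_vector_derivative[OF blinfun.bounded_linear_left])
        then show "((\<lambda>s. ?w s - ?u s - s *\<^sub>R A (?u s) k) has_vector_derivative
            A (?w s) (y + k) - A (?u s) y - (s *\<^sub>R A' (?u s) (A (?u s) y) k + A (?u s) k)) (at s within {0..1})"
          using ud[OF y s] ud[OF yk s]
          by (auto intro!: derivative_eq_intros has_vector_derivative_diff)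
        let ?q = "?w s - ?u s - s *\<^sub>R A (?u s) k"
        let ?R = "A (?w s) - A (?u s) - A' (?u s) (?w s - ?u s)"
        \<comment> \<open>Flatness rewrites \<open>A' (?u s) (A (?u s) y) k\<close> as
          \<open>A' (?u s) (A (?u s) k) y\<close>. That term then merges with the linear part of
          \<open>A (?w s) - A (?u s)\<close> into \<open>A' (?u s) ?q y\<close>, leaving only small
          errors.\<close>
        have split: "A (?w s) (y + k) - A (?u s) y - (s *\<^sub>R A' (?u s) (A (?u s) y) k + A (?u s) k)
            = A' (?u s) ?q y + ?R y + (A (?w s) - A (?u s)) k"
          using flat[of "?u s" y k] us sub
          by (auto simp: blinfun.bilinear_simps algebra_simps)
        have wu: "norm (?w s - ?u s) \<le> 2 * K * norm k"
          by (rule dif[OF y yk s])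
        have "norm (A' (?u s) ?q y) \<le> norm (A' (?u s)) * norm ?q * norm y"
          by (meson mult_right_mono norm_blinfun norm_ge_zero order_trans)
        also have "\<dots> \<le> L * norm ?q * r"
          using L[OF us] y KL0 by (intro mult_mono) auto
        finally have 1: "norm (A' (?u s) ?q y) \<le> r * L * norm ?q"
          by (simp add: mult_ac)
        have "norm (?R y) \<le> norm ?R * norm y"
          by (rule norm_blinfun)
        also have "\<dots> \<le> (e1 * (2 * K * norm k)) * r"
        proof (rule mult_mono)
          show "norm ?R \<le> e1 * (2 * K * norm k)"
            using lin[OF us ws close[OF s]] mult_left_mono[OF wu, of e1] e1 by linarith
        qed (use y e1 KL0 in auto)
        finally have 2: "norm (?R y) \<le> (e1 * (2 * K * norm k)) * r" .
        have "norm ((A (?w s) - A (?u s)) k) \<le> norm (A (?w s) - A (?u s)) * norm k"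
          by (rule norm_blinfun)
        also have "\<dots> \<le> L * (2 * K * norm k) * norm k"
          using lip[OF ws us] mult_left_mono[OF wu KL0(2)] by (intro mult_right_mono) auto
        finally have 3: "norm ((A (?w s) - A (?u s)) k) \<le> L * (2 * K * norm k) * norm k" .
        show "norm (A (?w s) (y + k) - A (?u s) y - (s *\<^sub>R A' (?u s) (A (?u s) y) k + A (?u s) k))
            \<le> r * L * norm ?q + err"
          unfolding split err_def using 1 2 3
          by (intro order_trans[OF norm_triangle_ineq]) (smt (verit) norm_triangle_ineq)
      qed (use u0 y yk r KL0 rL in auto)
      also have "2 * 1 * err = (4 * K * r * e1 + 4 * L * K * norm k) * norm k"
        by (simp add: err_def algebra_simps)
      also have "\<dots> \<le> e * norm k"
      proof (rule mult_right_mono)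
        have half: "4 * (a * b) * (e / (8 * a * b)) = e / 2" if "a \<noteq> 0" "b \<noteq> 0" for a b :: real
          using that by (simp add: field_simps)
        have "K * r \<le> (K + 1) * (r + 1)"
          using KL0 r by (intro mult_mono) auto
        then have "4 * K * r * e1 \<le> 4 * ((K + 1) * (r + 1)) * e1"
          using e1 by simp
        also have "\<dots> = e / 2"
          unfolding e1_def by (rule half) (use KL0 r in auto)
        finally have a: "4 * K * r * e1 \<le> e / 2" .
        have "L * K \<le> (L + 1) * (K + 1)"
          using KL0 by (intro mult_mono) auto
        then have "(L * K) * norm k \<le> ((L + 1) * (K + 1)) * d"
          using KL0 k d(1) by (intro mult_mono) auto
        then have "4 * L * K * norm k \<le> 4 * ((L + 1) * (K + 1)) * d"
          by simp
        also have "\<dots> \<le> 4 * ((L + 1) * (K + 1)) * (e / (8 * (L + 1) * (K + 1)))"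
          using KL0 d(4) by (intro mult_left_mono) auto
        also have "\<dots> = e / 2"
          by (rule half) (use KL0 in auto)
        finally have b: "4 * L * K * norm k \<le> e / 2" .
        show "4 * K * r * e1 + 4 * L * K * norm k \<le> e"
          using a b by linarith
      qed simp
      finally show ?thesis by (simp add: F_def)
    qed
    show "\<exists>d>0. \<forall>z. norm (z - y) < d \<longrightarrow> norm (F z - F y - A (F y) (z - y)) \<le> e * norm (z - y)"
      using d(1) main[of "z - y" for z] by (intro exI[of _ d]) auto
  qed
  \<comment> \<open>For \<open>y = 0\<close> the field vanishes and the solution is
    constant.\<close>
  have F0: "F 0 = x0"
  proof -
    have z: "0 \<in> ball (0::'y) r" using r by simp
    have "norm (u 0 1 - x0) \<le> 2 * 1 * 0"
      by (rule small_gronwall[where m = 0 and \<tau> = 1 and q' = "\<lambda>s. 0"])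
        (use u0[OF z] ud[OF z] in \<open>auto intro!: derivative_eq_intros\<close>)
    then show ?thesis by (simp add: F_def)
  qed
  have "F y \<in> B" if "y \<in> ball 0 r" for y
    unfolding F_def using ub[OF that, of 1] sub by auto
  with that r F0 Fder show thesis by blast
qed

text \<open>Both \<open>\<gamma>\<close> and \<open>F\<close> composed with \<open>c\<close> start
  at \<open>x0\<close> and solve the time-dependent equation whose velocity at \<open>x\<close> is
  \<open>A x (c' t)\<close>. This is Lipschitz in \<open>x\<close> with constant
  \<open>L * C\<close>, so the two curves agree as long as they stay in a ball where the bounds
  hold.\<close>

lemma flat_field_lift:
  fixes A :: "'x::euclidean_space \<Rightarrow> ('y::euclidean_space \<Rightarrow>\<^sub>L 'x)"
    and A' :: "'x \<Rightarrow> ('x \<Rightarrow>\<^sub>L ('y \<Rightarrow>\<^sub>L 'x))"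
  assumes B: "open B" "x0 \<in> B"
    and der: "\<And>x. x \<in> B \<Longrightarrow> (A has_derivative A' x) (at x)"
    and cont: "continuous_on B A'"
    and r: "0 < r" and F0: "F 0 = x0"
    and Fder: "\<And>y. y \<in> ball 0 r \<Longrightarrow> (F has_derivative A (F y)) (at y)"
    and \<tau>: "0 < \<tau>" and c0: "c 0 = 0" and g0: "\<gamma> 0 = x0"
    and cder: "\<And>t. t \<in> {0..\<tau>} \<Longrightarrow> (c has_vector_derivative c' t) (at t within {0..\<tau>})"
    and gder: "\<And>t. t \<in> {0..\<tau>} \<Longrightarrow> (\<gamma> has_vector_derivative A (\<gamma> t) (c' t)) (at t within {0..\<tau>})"
    and bd: "\<And>t. t \<in> {0..\<tau>} \<Longrightarrow> norm (c' t) \<le> C"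
  obtains \<tau>' where "0 < \<tau>'" "\<tau>' \<le> \<tau>" "\<And>t. t \<in> {0..\<tau>'} \<Longrightarrow> \<gamma> t = F (c t)"
proof -
  have derB: "\<forall>x\<in>B. (A has_derivative A' x) (at x)"
    using der by blast
  obtain \<rho> K L where \<rho>: "0 < \<rho>" and KL0: "0 \<le> K" "0 \<le> L" and sub: "cball x0 \<rho> \<subseteq> B"
    and "\<And>x. x \<in> cball x0 \<rho> \<Longrightarrow> norm (A x) \<le> K" "\<And>x. x \<in> cball x0 \<rho> \<Longrightarrow> norm (A' x) \<le> L"
    and lip: "\<And>x y. \<lbrakk>x \<in> cball x0 \<rho>; y \<in> cball x0 \<rho>\<rbrakk> \<Longrightarrow> norm (A x - A y) \<le> L * norm (x - y)"
    using C1_local_bounds[OF B derB cont] by blast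
  have "norm (c' 0) \<le> C"
    using bd[of 0] \<tau> by simp
  then have C0: "0 \<le> C"
    using norm_ge_zero[of "c' 0"] by linarith
  have t0: "0 \<in> {0..\<tau>}" using \<tau> by simp
  have cc: "(c \<longlongrightarrow> 0) (at 0 within {0..\<tau>})"
    using has_vector_derivative_continuous[OF cder[OF t0]] c0 by (simp add: continuous_within)
  have gc: "(\<gamma> \<longlongrightarrow> x0) (at 0 within {0..\<tau>})"
    using has_vector_derivative_continuous[OF gder[OF t0]] g0 by (simp add: continuous_within)
  have "isCont F 0"
    using Fder[of 0] r has_derivative_continuous by auto
  then have Fc: "((\<lambda>t. F (c t)) \<longlongrightarrow> x0) (at 0 within {0..\<tau>})"
    using isCont_tendsto_compose[OF _ cc] F0 by metis
  have "\<forall>\<^sub>F t in at 0 within {0..\<tau>}. dist (c t) 0 < r \<and> dist (\<gamma> t) x0 < \<rho> \<and> dist (F (c t)) x0 < \<rho>"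
    using tendstoD[OF cc r] tendstoD[OF gc \<rho>] tendstoD[OF Fc \<rho>] by eventually_elim auto
  then obtain d where d: "0 < d"
    and near: "\<And>t. \<lbrakk>t \<in> {0..\<tau>}; t \<noteq> 0; dist t 0 < d\<rbrakk> \<Longrightarrow>
       dist (c t) 0 < r \<and> dist (\<gamma> t) x0 < \<rho> \<and> dist (F (c t)) x0 < \<rho>"
    unfolding eventually_at by blast
  \<comment> \<open>Half of \<open>d\<close> leaves a strict inequality at the right end of the
    closed interval; the last entry gives the bound 1/2 on \<open>\<tau>' * (L * C)\<close> for the
    Gronwall step.\<close>
  define \<tau>' where "\<tau>' = Min {\<tau>, d / 2, 1 / (2 * (L * C + 1))}"
  have LC: "0 \<le> L * C" using KL0 C0 by simp
  have \<tau>': "0 < \<tau>'" "\<tau>' \<le> \<tau>" "\<tau>' < d" "\<tau>' \<le> 1 / (2 * (L * C + 1))"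
    using \<tau> d LC by (auto simp: \<tau>'_def)
  have near': "c t \<in> ball 0 r" "\<gamma> t \<in> cball x0 \<rho>" "F (c t) \<in> cball x0 \<rho>" if "t \<in> {0..\<tau>'}" for t
    using near[of t] that \<tau>' r \<rho> c0 g0 F0
    by (cases "t = 0"; force simp: dist_commute less_imp_le)+
  have "\<gamma> t = F (c t)" if t: "t \<in> {0..\<tau>'}" for t
  proof -
    have "norm (\<gamma> t - F (c t)) \<le> 2 * \<tau>' * 0"
    proof (rule small_gronwall[where m = "L * C" and q' = "\<lambda>s. A (\<gamma> s) (c' s) - A (F (c s)) (c' s)"])
      fix s assume s: "s \<in> {0..\<tau>'}"
      then have s': "s \<in> {0..\<tau>}" and ss: "{0..\<tau>'} \<subseteq> {0..\<tau>}"
        using \<tau>' by auto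
      have "((\<lambda>s. F (c s)) has_vector_derivative A (F (c s)) (c' s)) (at s within {0..\<tau>'})"
        by (rule has_vector_derivative_blinfun_compose[OF has_vector_derivative_within_subset[OF cder[OF s'] ss]])
          (rule Fder[OF near'(1)[OF s]])
      then show "((\<lambda>s. \<gamma> s - F (c s)) has_vector_derivative A (\<gamma> s) (c' s) - A (F (c s)) (c' s)) (at s within {0..\<tau>'})"
        using has_vector_derivative_within_subset[OF gder[OF s'] ss] by (intro has_vector_derivative_diff)
      have "norm (A (\<gamma> s) (c' s) - A (F (c s)) (c' s)) \<le> norm (A (\<gamma> s) - A (F (c s))) * norm (c' s)"
        using norm_blinfun[of "A (\<gamma> s) - A (F (c s))" "c' s"] by (simp add: blinfun.diff_left)
      also have "\<dots> \<le> (L * norm (\<gamma> s - F (c s))) * C"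
        using lip[OF near'(2)[OF s] near'(3)[OF s]] bd[OF s'] KL0 by (intro mult_mono) auto
      finally show "norm (A (\<gamma> s) (c' s) - A (F (c s)) (c' s)) \<le> L * C * norm (\<gamma> s - F (c s)) + 0"
        by (simp add: mult_ac)
    next
      have "\<tau>' * (L * C) \<le> 1 / (2 * (L * C + 1)) * (L * C)"
        using \<tau>'(4) LC by (rule mult_right_mono)
      also have "\<dots> \<le> 1 / 2"
        using LC by (simp add: field_simps)
      finally show "\<tau>' * (L * C) \<le> 1 / 2" .
    qed (use \<tau>' c0 g0 F0 LC t in auto)
    then show ?thesis by simp
  qed
  with that \<tau>' show thesis by blast
qed

subsection \<open>C1 calculus and symmetry of second derivatives\<close>

lemma Ck_1I:
  assumes "\<And>x. x \<in> S \<Longrightarrow> (f has_derivative f' x) (at x)"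
    and "\<And>v. continuous_on S (\<lambda>x. f' x v)"
  shows "Ck_on 1 S f"
proof -
  have "frechet_derivative f (at x) = f' x" if "x \<in> S" for x
    using frechet_derivative_at[OF assms(1)[OF that]] by simp
  then have "continuous_on S (\<lambda>x. frechet_derivative f (at x) v)" for v
    using assms(2)[of v] by (simp cong: continuous_on_cong)
  then show ?thesis
    using assms(1) by (auto simp: differentiable_def)
qed

lemma Ck_1E:
  assumes "Ck_on 1 S f"
  obtains f' where "\<And>x. x \<in> S \<Longrightarrow> (f has_derivative f' x) (at x)"
    "\<And>v. continuous_on S (\<lambda>x. f' x v)"
  using assms by (auto simp: frechet_derivative_works intro: that)

lemma Ck_1_continuous_on: "Ck_on 1 S f \<Longrightarrow> continuous_on S f"
  by (erule Ck_1E) (meson continuous_at_imp_continuous_on has_derivative_continuous)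

lemma Ck_on_subset: "Ck_on k S f \<Longrightarrow> T \<subseteq> S \<Longrightarrow> Ck_on k T f"
  by (induction k arbitrary: f) (auto intro: continuous_on_subset)

lemma Ck_1_const: "Ck_on 1 S (\<lambda>x. c)"
  by (rule Ck_1I[where f' = "\<lambda>x v. 0"]) auto

lemma Ck_1_add:
  assumes "Ck_on 1 S f" "Ck_on 1 S g"
  shows "Ck_on 1 S (\<lambda>x. f x + g x)"
proof -
  obtain f' where f: "\<And>x. x \<in> S \<Longrightarrow> (f has_derivative f' x) (at x)"
    "\<And>v. continuous_on S (\<lambda>x. f' x v)" using assms(1) by (rule Ck_1E) blast
  obtain g' where g: "\<And>x. x \<in> S \<Longrightarrow> (g has_derivative g' x) (at x)"
    "\<And>v. continuous_on S (\<lambda>x. g' x v)" using assms(2) by (rule Ck_1E) blast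
  show ?thesis
    by (rule Ck_1I[where f' = "\<lambda>x v. f' x v + g' x v"])
      (use f g in \<open>auto intro!: has_derivative_add continuous_on_add\<close>)
qed

lemma Ck_1_sum:
  assumes "\<And>i. i \<in> I \<Longrightarrow> Ck_on 1 S (f i)"
  shows "Ck_on 1 S (\<lambda>x. \<Sum>i\<in>I. f i x)"
  using assms
proof (induction I rule: infinite_finite_induct)
  case (insert i I)
  then have "Ck_on 1 S (\<lambda>x. f i x + (\<Sum>i\<in>I. f i x))"
    by (intro Ck_1_add) blast+
  moreover have "(\<lambda>x. \<Sum>i\<in>insert i I. f i x) = (\<lambda>x. f i x + (\<Sum>i\<in>I. f i x))"
    using insert.hyps by simp
  ultimately show ?case
    by (simp only:)
qed (simp_all add: Ck_1_const del: Ck_on.simps One_nat_def)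

lemma Ck_1_bilinear:
  assumes "bounded_bilinear p" "Ck_on 1 S f" "Ck_on 1 S g"
  shows "Ck_on 1 S (\<lambda>x. p (f x) (g x))"
proof -
  interpret p: bounded_bilinear p by fact
  obtain f' where f: "\<And>x. x \<in> S \<Longrightarrow> (f has_derivative f' x) (at x)"
    "\<And>v. continuous_on S (\<lambda>x. f' x v)" using assms(2) by (rule Ck_1E) blast
  obtain g' where g: "\<And>x. x \<in> S \<Longrightarrow> (g has_derivative g' x) (at x)"
    "\<And>v. continuous_on S (\<lambda>x. g' x v)" using assms(3) by (rule Ck_1E) blast
  show ?thesis
    by (rule Ck_1I[where f' = "\<lambda>x v. p (f x) (g' x v) + p (f' x v) (g x)"])
      (use f g Ck_1_continuous_on[OF assms(2)] Ck_1_continuous_on[OF assms(3)] in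
        \<open>auto intro!: p.FDERIV p.continuous_on continuous_on_add\<close>)
qed

lemma Ck_1_bounded_linear:
  assumes "bounded_linear p" "Ck_on 1 S f"
  shows "Ck_on 1 S (\<lambda>x. p (f x))"
proof -
  obtain f' where f: "\<And>x. x \<in> S \<Longrightarrow> (f has_derivative f' x) (at x)"
    "\<And>v. continuous_on S (\<lambda>x. f' x v)" using assms(2) by (rule Ck_1E) blast
  show ?thesis
    by (rule Ck_1I[where f' = "\<lambda>x v. p (f' x v)"])
      (use f in \<open>auto intro!: bounded_linear.has_derivative[OF assms(1)] bounded_linear.continuous_on[OF assms(1)]\<close>)
qed

text \<open>Rebuilds an operator from its finitely many values on the basis, so that regularity of
  these values passes to the operator-valued map.\<close>

lemma blinfun_Basis_expansion:
  fixes A :: "'x::euclidean_space \<Rightarrow>\<^sub>L 'z::real_normed_vector"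
  shows "A = (\<Sum>b\<in>Basis. blinfun_scaleR_left (A b) o\<^sub>L blinfun_inner_right b)"
proof (rule blinfun_eqI)
  fix h
  have "A h = A (\<Sum>b\<in>Basis. (h \<bullet> b) *\<^sub>R b)"
    by (simp add: euclidean_representation)
  then show "A h = (\<Sum>b\<in>Basis. blinfun_scaleR_left (A b) o\<^sub>L blinfun_inner_right b) h"
    by (simp add: blinfun.sum_right blinfun.sum_left blinfun.scaleR_right inner_commute)
qed

text \<open>In finite dimension, continuity of every directional derivative already gives continuity
  of the derivative in operator norm, through the basis expansion.\<close>

lemma Ck_1_imp_C1:
  fixes f :: "'x::euclidean_space \<Rightarrow> 'z::real_normed_vector"
  assumes "Ck_on 1 S f"
  obtains f' :: "'x \<Rightarrow> 'x \<Rightarrow>\<^sub>L 'z"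
  where "\<And>x. x \<in> S \<Longrightarrow> (f has_derivative f' x) (at x)" "continuous_on S f'"
proof -
  obtain D where D: "\<And>x. x \<in> S \<Longrightarrow> (f has_derivative D x) (at x)"
    and Dc: "\<And>v. continuous_on S (\<lambda>x. D x v)" using assms by (rule Ck_1E) blast
  define f' where "f' x = (\<Sum>b\<in>Basis. blinfun_scaleR_left (D x b) o\<^sub>L blinfun_inner_right b)" for x
  have "blinfun_apply (f' x) = D x" if "x \<in> S" for x
  proof -
    have bl: "blinfun_apply (Blinfun (D x)) = D x"
      using D[OF that] by (intro bounded_linear_Blinfun_apply has_derivative_bounded_linear)
    show ?thesis
      using blinfun_Basis_expansion[of "Blinfun (D x)"] unfolding f'_def bl by (metis bl)
  qed
  moreover have "continuous_on S f'"
    unfolding f'_def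
    by (intro continuous_on_sum bounded_bilinear.continuous_on[OF bounded_bilinear_blinfun_compose]
        continuous_on_const bounded_linear.continuous_on[OF bounded_linear_blinfun_scaleR_left] Dc)
  ultimately show thesis
    using that D by metis
qed

text \<open>The derivative of a \<open>C^2\<close> map as an operator-valued \<open>C^1\<close> map,
  to which products, adjoints and inverses of operators can be applied.\<close>

lemma Ck_1_frechet_derivative_blinfun:
  fixes f :: "'x::euclidean_space \<Rightarrow> 'z::real_normed_vector"
  assumes "Ck_on 2 S f"
  obtains J :: "'x \<Rightarrow> 'x \<Rightarrow>\<^sub>L 'z"
  where "\<And>x. x \<in> S \<Longrightarrow> (f has_derivative J x) (at x)" "Ck_on 1 S J"
proof -
  let ?D = "\<lambda>x. frechet_derivative f (at x)"
  define J where "J x = (\<Sum>b\<in>Basis. blinfun_scaleR_left (?D x b) o\<^sub>L blinfun_inner_right b)" for x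
  have diff: "f differentiable (at x)" if "x \<in> S" for x
    using assms that by (simp add: numeral_2_eq_2)
  have D1: "Ck_on 1 S (\<lambda>x. ?D x v)" for v
    using assms by (simp add: numeral_2_eq_2)
  have "blinfun_apply (J x) = ?D x" if "x \<in> S" for x
  proof -
    have bl: "blinfun_apply (Blinfun (?D x)) = ?D x"
      using diff[OF that] frechet_derivative_works has_derivative_bounded_linear
      by (intro bounded_linear_Blinfun_apply) blast
    show ?thesis
      using blinfun_Basis_expansion[of "Blinfun (?D x)"] unfolding J_def bl by (metis bl)
  qed
  moreover have "Ck_on 1 S J"
    unfolding J_def
    by (intro Ck_1_sum Ck_1_bilinear[OF bounded_bilinear_blinfun_compose] Ck_1_const
        Ck_1_bounded_linear[OF bounded_linear_blinfun_scaleR_left] D1)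
  ultimately show thesis
    using that diff frechet_derivative_works by metis
qed

text \<open>The mean value inequality is applied in the direction \<open>h\<close> to the increment
  of \<open>f\<close> along \<open>t *\<^sub>R k\<close>, minus its expected linear part. The
  derivative of this function is a difference of two linearization errors of \<open>J\<close> at
  \<open>x\<close>.\<close>

lemma second_difference_estimate:
  fixes f :: "'x::real_normed_vector \<Rightarrow> 'z::real_normed_vector" and J :: "'x \<Rightarrow> 'x \<Rightarrow>\<^sub>L 'z"
    and J' :: "'x \<Rightarrow>\<^sub>L 'x \<Rightarrow>\<^sub>L 'z"
  assumes B: "open B" "x \<in> B"
    and f: "\<And>z. z \<in> B \<Longrightarrow> (f has_derivative J z) (at z)"
    and J: "(J has_derivative J') (at x)" and e: "0 < e"
  shows "\<exists>d>0. \<forall>t. 0 < t \<and> t < d \<longrightarrow>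
    norm (f (x + t *\<^sub>R h + t *\<^sub>R k) - f (x + t *\<^sub>R h) - (f (x + t *\<^sub>R k) - f x) - t\<^sup>2 *\<^sub>R J' k h)
      \<le> 2 * e * (norm h + norm k)\<^sup>2 * t\<^sup>2"
proof -
  define m where "m = norm h + norm k"
  have m: "0 \<le> m" "norm h \<le> m" "norm k \<le> m" by (simp_all add: m_def)
  obtain d1 where d1: "0 < d1"
    and lin: "\<And>z. norm (z - x) < d1 \<Longrightarrow> norm (J z - J x - J' (z - x)) \<le> e * norm (z - x)"
    using J e unfolding has_derivative_at_alt by blast
  obtain d2 where d2: "0 < d2" and ball: "ball x d2 \<subseteq> B"
    using B open_contains_ball by blast
  define d where "d = min d1 d2 / (m + 1)"
  have d: "0 < d" using d1 d2 m by (simp add: d_def)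
  have "norm (f (x + t *\<^sub>R h + t *\<^sub>R k) - f (x + t *\<^sub>R h) - (f (x + t *\<^sub>R k) - f x) - t\<^sup>2 *\<^sub>R J' k h)
      \<le> 2 * e * m\<^sup>2 * t\<^sup>2" if t: "0 < t" "t < d" for t
  proof -
    have tm: "t * m < min d1 d2"
    proof -
      have "t * m \<le> t * (m + 1)" using t m by simp
      also have "\<dots> < min d1 d2" using t m by (simp add: d_def field_simps)
      finally show ?thesis .
    qed
    define g where "g s = f (x + s *\<^sub>R h + t *\<^sub>R k) - f (x + s *\<^sub>R h) - s *\<^sub>R t *\<^sub>R J' k h" for s
    define g' where "g' s = J (x + s *\<^sub>R h + t *\<^sub>R k) h - J (x + s *\<^sub>R h) h - t *\<^sub>R J' k h" for s
    have n1: "norm (s *\<^sub>R h + t *\<^sub>R k) \<le> t * m" and n2: "norm (s *\<^sub>R h) \<le> t * m"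
      if "s \<in> {0..t}" for s
    proof -
      have "s * norm h \<le> t * norm h" using that by (intro mult_right_mono) auto
      moreover have "norm (s *\<^sub>R h + t *\<^sub>R k) \<le> s * norm h + t * norm k"
        using norm_triangle_ineq[of "s *\<^sub>R h" "t *\<^sub>R k"] that t by simp
      moreover have "0 \<le> t * norm k" using t by simp
      moreover have "norm (s *\<^sub>R h) = s * norm h" using that by simp
      ultimately show "norm (s *\<^sub>R h + t *\<^sub>R k) \<le> t * m" "norm (s *\<^sub>R h) \<le> t * m"
        unfolding m_def distrib_left by linarith+
    qed
    have "norm (g t - g 0) \<le> (2 * e * m\<^sup>2 * t) * norm (t - 0)"
    proof (rule differentiable_bound[where S = "{0..t}" and f' = "\<lambda>s a. a *\<^sub>R g' s"])
      fix s assume s: "s \<in> {0..t}"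
      have "norm (x + s *\<^sub>R h + t *\<^sub>R k - x) < min d1 d2" "norm (x + s *\<^sub>R h - x) < min d1 d2"
        using n1[OF s] n2[OF s] tm by (simp_all add: add.assoc)
      then have inB: "x + s *\<^sub>R h + t *\<^sub>R k \<in> B" "x + s *\<^sub>R h \<in> B"
        using ball by (auto simp: dist_norm norm_minus_commute subset_iff)
      have "((\<lambda>s. f (x + s *\<^sub>R h + t *\<^sub>R k)) has_vector_derivative J (x + s *\<^sub>R h + t *\<^sub>R k) h) (at s within {0..t})"
        "((\<lambda>s. f (x + s *\<^sub>R h)) has_vector_derivative J (x + s *\<^sub>R h) h) (at s within {0..t})"
        by (rule has_vector_derivative_blinfun_compose[where A = f];
            use f inB in \<open>auto intro!: derivative_eq_intros\<close>)+
      then show "(g has_derivative (\<lambda>a. a *\<^sub>R g' s)) (at s within {0..t})"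
        unfolding g_def[abs_def] g'_def has_vector_derivative_def[symmetric]
        by (auto intro!: derivative_eq_intros has_vector_derivative_diff)
      let ?E = "\<lambda>z. J z - J x - J' (z - x)"
      \<comment> \<open>The terms \<open>J x h\<close> cancel, and \<open>J'\<close> at the
        difference of the two displacements is \<open>t *\<^sub>R J' k\<close>.\<close>
      have eq: "g' s = ?E (x + s *\<^sub>R h + t *\<^sub>R k) h - ?E (x + s *\<^sub>R h) h"
        by (simp add: g'_def blinfun.bilinear_simps algebra_simps)
      have E: "norm (?E (x + v) h) \<le> e * m\<^sup>2 * t" if v: "norm v \<le> t * m" for v
      proof -
        have "norm (?E (x + v) h) \<le> norm (?E (x + v)) * norm h"
          by (rule norm_blinfun)
        also have "\<dots> \<le> (e * norm v) * m"
          using lin[of "x + v"] v tm m e by (intro mult_mono) auto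
        also have "\<dots> \<le> (e * (t * m)) * m"
          using v e m by (intro mult_right_mono mult_left_mono) auto
        finally show ?thesis by (simp add: power2_eq_square mult_ac)
      qed
      have "norm (g' s) \<le> 2 * e * m\<^sup>2 * t"
        using E[OF n1[OF s]] E[OF n2[OF s]]
          norm_triangle_ineq4[of "?E (x + (s *\<^sub>R h + t *\<^sub>R k)) h" "?E (x + s *\<^sub>R h) h"]
        unfolding eq add.assoc[of x] by linarith
      then show "onorm (\<lambda>a. a *\<^sub>R g' s) \<le> 2 * e * m\<^sup>2 * t"
        by (intro onorm_le) (simp add: mult.commute mult_left_mono)
    qed (use t in auto)
    then show ?thesis
      using t by (simp add: g_def power2_eq_square algebra_simps)
  qed
  then show ?thesis
    using d unfolding m_def by blast
qed

text \<open>The second difference is symmetric in \<open>h\<close> and \<open>k\<close>, while the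
  estimate above approximates it by both \<open>t\<^sup>2 *\<^sub>R J' k h\<close> and
  \<open>t\<^sup>2 *\<^sub>R J' h k\<close>. Dividing by the square of \<open>t\<close> bounds their
  distance by an arbitrarily small number.\<close>

lemma second_derivative_symmetric:
  fixes f :: "'x::real_normed_vector \<Rightarrow> 'z::real_normed_vector" and J :: "'x \<Rightarrow> 'x \<Rightarrow>\<^sub>L 'z"
    and J' :: "'x \<Rightarrow>\<^sub>L 'x \<Rightarrow>\<^sub>L 'z"
  assumes B: "open B" "x \<in> B"
    and f: "\<And>z. z \<in> B \<Longrightarrow> (f has_derivative J z) (at z)"
    and J: "(J has_derivative J') (at x)"
  shows "J' k h = J' h k"
proof -
  define m where "m = (norm h + norm k)\<^sup>2"
  have "norm (J' k h - J' h k) \<le> 4 * m * e" if e: "0 < e" for e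
  proof -
    have est: "\<exists>d>0. \<forall>t. 0 < t \<and> t < d \<longrightarrow>
        norm (f (x + t *\<^sub>R h + t *\<^sub>R k) - f (x + t *\<^sub>R h) - (f (x + t *\<^sub>R k) - f x) - t\<^sup>2 *\<^sub>R J' k h)
          \<le> 2 * e * (norm h + norm k)\<^sup>2 * t\<^sup>2" for h k
      using B f J e by (rule second_difference_estimate)
    obtain d1 where d1: "d1 > 0" "\<And>t. 0 < t \<Longrightarrow> t < d1 \<Longrightarrow>
      norm (f (x + t *\<^sub>R h + t *\<^sub>R k) - f (x + t *\<^sub>R h) - (f (x + t *\<^sub>R k) - f x) - t\<^sup>2 *\<^sub>R J' k h) \<le> 2 * e * m * t\<^sup>2"
      using est[of h k] unfolding m_def by blast
    obtain d2 where d2: "d2 > 0" "\<And>t. 0 < t \<Longrightarrow> t < d2 \<Longrightarrow>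
      norm (f (x + t *\<^sub>R k + t *\<^sub>R h) - f (x + t *\<^sub>R k) - (f (x + t *\<^sub>R h) - f x) - t\<^sup>2 *\<^sub>R J' h k) \<le> 2 * e * m * t\<^sup>2"
      using est[of k h] unfolding m_def add.commute[of "norm k"] by blast
    define t where "t = min d1 d2 / 2"
    have t: "0 < t" "t < d1" "t < d2" using d1 d2 by (auto simp: t_def)
    let ?\<Delta> = "f (x + t *\<^sub>R h + t *\<^sub>R k) - f (x + t *\<^sub>R h) - (f (x + t *\<^sub>R k) - f x)"
    have \<Delta>: "f (x + t *\<^sub>R k + t *\<^sub>R h) - f (x + t *\<^sub>R k) - (f (x + t *\<^sub>R h) - f x) = ?\<Delta>"
      by (simp add: algebra_simps)
    have eq: "t\<^sup>2 *\<^sub>R (J' k h - J' h k) = (?\<Delta> - t\<^sup>2 *\<^sub>R J' h k) - (?\<Delta> - t\<^sup>2 *\<^sub>R J' k h)"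
      by (simp add: algebra_simps)
    have "norm (t\<^sup>2 *\<^sub>R (J' k h - J' h k)) \<le> 2 * e * m * t\<^sup>2 + 2 * e * m * t\<^sup>2"
      using norm_triangle_ineq4[of "?\<Delta> - t\<^sup>2 *\<^sub>R J' h k" "?\<Delta> - t\<^sup>2 *\<^sub>R J' k h"]
        d1(2)[OF t(1,2)] d2(2)[OF t(1,3)] unfolding eq \<Delta> by linarith
    then have "t\<^sup>2 * norm (J' k h - J' h k) \<le> t\<^sup>2 * (4 * m * e)"
      unfolding norm_scaleR by (simp add: mult_ac)
    then show ?thesis
      using t by (simp add: mult_le_cancel_left)
  qed
  then have bound: "norm (J' k h - J' h k) \<le> 4 * m * e" if "0 < e" for e
    using that by blast
  have m0: "0 \<le> m" by (simp add: m_def)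
  have "norm (J' k h - J' h k) \<le> 0 + e" if "0 < e" for e
  proof -
    have "norm (J' k h - J' h k) \<le> 4 * m * (e / (4 * m + 1))"
      using that m0 by (intro bound) simp
    also have "\<dots> \<le> e"
      using m0 that by (simp add: field_simps)
    finally show ?thesis by simp
  qed
  then have "norm (J' k h - J' h k) \<le> 0"
    by (rule field_le_epsilon)
  then show ?thesis by simp
qed

subsection \<open>Inverses and adjoints of operator-valued maps\<close>

text \<open>Injectivity at \<open>x0\<close> means a lower bound on \<open>norm (G x0 v)\<close>,
  which survives with half the constant nearby; in finite dimension this makes \<open>G x\<close>
  invertible. The derivative of the inverse is the familiar \<open>- H G' H\<close>.\<close>

lemma Ck_1_blinfun_inverse:
  fixes G :: "'x::euclidean_space \<Rightarrow> ('y::euclidean_space \<Rightarrow>\<^sub>L 'y)"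
  assumes B: "open B" "x0 \<in> B" and G: "Ck_on 1 B G" and inj: "inj (blinfun_apply (G x0))"
  obtains B1 and H :: "'x \<Rightarrow> ('y \<Rightarrow>\<^sub>L 'y)"
  where "open B1" "x0 \<in> B1" "B1 \<subseteq> B" "Ck_on 1 B1 H"
    "\<And>x v. x \<in> B1 \<Longrightarrow> H x (G x v) = v" "\<And>x v. x \<in> B1 \<Longrightarrow> G x (H x v) = v"
proof -
  have lin: "linear (blinfun_apply A)" for A :: "'y \<Rightarrow>\<^sub>L 'y"
    by (intro bounded_linear.linear blinfun.bounded_linear_right)
  obtain c where c: "0 < c" and below0: "\<And>v. c * norm v \<le> norm (G x0 v)"
    using linear_inj_bounded_below_pos[OF lin inj] by blast
  define B1 where "B1 = B \<inter> G -` ball (G x0) (c / 2)"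
  have B1: "open B1" "x0 \<in> B1" "B1 \<subseteq> B"
    using B c continuous_open_preimage[OF Ck_1_continuous_on[OF G]] by (auto simp: B1_def)
  have below: "c / 2 * norm v \<le> norm (G x v)" if "x \<in> B1" for x v
  proof -
    have "norm ((G x0 - G x) v) \<le> norm (G x0 - G x) * norm v"
      by (rule norm_blinfun)
    also have "\<dots> \<le> c / 2 * norm v"
      using that by (intro mult_right_mono) (auto simp: B1_def dist_norm)
    finally show ?thesis
      using below0[of v] norm_triangle_sub[of "G x0 v" "G x v"] by (simp add: blinfun.diff_left)
  qed
  have "\<exists>h. (\<forall>v. blinfun_apply h (G x v) = v) \<and> (\<forall>v. G x (blinfun_apply h v) = v)" if x: "x \<in> B1" for x
  proof -
    have "inj (blinfun_apply (G x))"
    proof (rule linear_injective_0[OF lin, THEN iffD2], intro allI impI)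
      fix v assume "G x v = 0"
      then show "v = 0" using below[OF x, of v] c by (simp add: mult_le_0_iff)
    qed
    then obtain h where h: "linear h" "\<And>v. h (G x v) = v" "\<And>v. G x (h v) = v"
      using linear_injective_isomorphism[OF lin, of "G x"] by blast
    have "blinfun_apply (Blinfun h) = h"
      using h(1) by (intro bounded_linear_Blinfun_apply) (simp add: linear_conv_bounded_linear)
    with h show ?thesis by metis
  qed
  then obtain H :: "'x \<Rightarrow> ('y \<Rightarrow>\<^sub>L 'y)"
    where HG: "\<And>x v. x \<in> B1 \<Longrightarrow> H x (G x v) = v" and GH: "\<And>x v. x \<in> B1 \<Longrightarrow> G x (H x v) = v"
    by metis
  have Hn: "norm (H x) \<le> 2 / c" if x: "x \<in> B1" for x
  proof (rule norm_blinfun_bound)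
    fix v
    have "c / 2 * norm (H x v) \<le> norm v" using below[OF x, of "H x v"] GH[OF x] by simp
    then show "norm (H x v) \<le> 2 / c * norm v" using c by (simp add: field_simps)
  qed (use c in auto)
  \<comment> \<open>The resolvent identity; it yields the Lipschitz estimate and hence continuity of
    \<open>H\<close>.\<close>
  have resolvent: "H y - H x = H y o\<^sub>L (G x - G y) o\<^sub>L H x" if "x \<in> B1" "y \<in> B1" for x y
    by (rule blinfun_eqI) (simp add: blinfun.bilinear_simps HG GH that)
  have Hlip: "norm (H y - H x) \<le> (2 / c)\<^sup>2 * norm (G y - G x)" if "x \<in> B1" "y \<in> B1" for x y
  proof -
    have "norm (H y - H x) \<le> norm (H y) * norm (G x - G y) * norm (H x)"
      unfolding resolvent[OF that]
      by (meson mult_right_mono norm_blinfun_compose norm_ge_zero order_trans)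
    also have "\<dots> \<le> (2 / c) * norm (G x - G y) * (2 / c)"
      using Hn that c by (intro mult_mono) auto
    finally show ?thesis by (simp add: power2_eq_square norm_minus_commute mult_ac)
  qed
  obtain G' where G': "\<And>x. x \<in> B \<Longrightarrow> (G has_derivative G' x) (at x)" "\<And>v. continuous_on B (\<lambda>x. G' x v)"
    using G by (rule Ck_1E) blast
  have Hcont: "continuous_on B1 H"
    unfolding continuous_on_def
  proof
    fix x assume x: "x \<in> B1"
    have "((\<lambda>y. (2 / c)\<^sup>2 * norm (G y - G x)) \<longlongrightarrow> (2 / c)\<^sup>2 * norm (G x - G x)) (at x within B1)"
      using continuous_on_subset[OF Ck_1_continuous_on[OF G] B1(3)] x
      by (intro tendsto_intros) (simp add: continuous_on_def)
    then have "((\<lambda>y. (2 / c)\<^sup>2 * norm (G y - G x)) \<longlongrightarrow> 0) (at x within B1)" by simp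
    then have "((\<lambda>y. H y - H x) \<longlongrightarrow> 0) (at x within B1)"
      by (rule Lim_null_comparison[rotated])
        (use Hlip[OF x] in \<open>auto simp: eventually_at_filter\<close>)
    then show "(H \<longlongrightarrow> H x) (at x within B1)" by (simp add: LIM_zero_iff)
  qed
  have Hder: "(H has_derivative (\<lambda>h. - (H x o\<^sub>L G' x h o\<^sub>L H x))) (at x)" if x: "x \<in> B1" for x
  proof -
    \<comment> \<open>The first-order expansion of \<open>H\<close> around \<open>x\<close>. It has
      the desired derivative, and what remains is to see that \<open>H\<close> minus this expansion
      is of second order.\<close>
    let ?L = "\<lambda>y. H x - (H x o\<^sub>L (G y - G x) o\<^sub>L H x)"
    have xB: "x \<in> B" using B1 x by blast
    have bl: "bounded_linear (\<lambda>T. H x o\<^sub>L T o\<^sub>L H x)"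
      using bounded_linear_compose[OF bounded_bilinear.bounded_linear_left[OF bounded_bilinear_blinfun_compose]
          bounded_bilinear.bounded_linear_right[OF bounded_bilinear_blinfun_compose]] .
    have "((\<lambda>y. G y - G x) has_derivative G' x) (at x)"
      using has_derivative_diff[OF G'(1)[OF xB] has_derivative_const[of "G x"]] by simp
    then have "((\<lambda>y. H x o\<^sub>L (G y - G x) o\<^sub>L H x) has_derivative (\<lambda>h. H x o\<^sub>L G' x h o\<^sub>L H x)) (at x)"
      by (rule bounded_linear.has_derivative[OF bl])
    then have 1: "(?L has_derivative (\<lambda>h. - (H x o\<^sub>L G' x h o\<^sub>L H x))) (at x)"
      using has_derivative_diff[OF has_derivative_const[of "H x"]] by force
    have 2: "((\<lambda>y. H y - ?L y) has_derivative (\<lambda>h. 0)) (at x)"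
      unfolding has_derivative_at_alt
    proof (intro conjI allI impI)
      fix e :: real assume e: "0 < e"
      obtain M where M: "\<And>h. norm (G' x h) \<le> norm h * M"
        using has_derivative_bounded_linear[OF G'(1)[OF xB]] bounded_linear.bounded by blast
      obtain d1 where d1: "0 < d1"
        and "\<And>y. norm (y - x) < d1 \<Longrightarrow> norm (G y - G x - G' x (y - x)) \<le> 1 * norm (y - x)"
        using G'(1)[OF xB] unfolding has_derivative_at_alt by (metis zero_less_one)
      then have Glip: "norm (G y - G x) \<le> (\<bar>M\<bar> + 1) * norm (y - x)" if "norm (y - x) < d1" for y
        using that M[of "y - x"] norm_triangle_sub[of "G y - G x" "G' x (y - x)"]
          mult_left_mono[OF abs_ge_self[of M] norm_ge_zero[of "y - x"]]
        by (fastforce simp: algebra_simps)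
      obtain d2 where d2: "0 < d2" "ball x d2 \<subseteq> B1"
        using B1 x open_contains_ball by blast
      define K where "K = (2 / c)\<^sup>2 * (2 / c) * (\<bar>M\<bar> + 1)\<^sup>2"
      have K: "0 \<le> K" using c by (simp add: K_def)
      define d where "d = Min {d1, d2, e / (K + 1)}"
      have d: "0 < d" "d \<le> d1" "d \<le> d2" "d \<le> e / (K + 1)"
        using d1 d2 e K by (auto simp: d_def)
      have "norm (H y - ?L y - (H x - ?L x) - 0) \<le> e * norm (y - x)" if y: "norm (y - x) < d" for y
      proof -
        have yB: "y \<in> B1" using y d d2 by (auto simp: dist_norm norm_minus_commute)
        \<comment> \<open>The remainder contains the two factors \<open>H y - H x\<close> and
          \<open>G x - G y\<close>, each bounded by a multiple of
          \<open>norm (y - x)\<close>.\<close>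
        have "H y - ?L y - (H x - ?L x) - 0 = (H y - H x) o\<^sub>L (G x - G y) o\<^sub>L H x"
          by (rule blinfun_eqI) (simp add: blinfun.bilinear_simps HG GH x yB)
        also have "norm \<dots> \<le> norm (H y - H x) * norm (G x - G y) * norm (H x)"
          by (meson mult_right_mono norm_blinfun_compose norm_ge_zero order_trans)
        also have "\<dots> \<le> ((2 / c)\<^sup>2 * norm (G y - G x)) * norm (G y - G x) * (2 / c)"
          using Hlip[OF x yB] Hn[OF x] c by (intro mult_mono) (auto simp: norm_minus_commute)
        also have "\<dots> = (2 / c)\<^sup>2 * (2 / c) * (norm (G y - G x))\<^sup>2"
          by (simp add: power2_eq_square)
        also have "\<dots> \<le> (2 / c)\<^sup>2 * (2 / c) * ((\<bar>M\<bar> + 1) * norm (y - x))\<^sup>2"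
          using Glip[of y] y d c by (intro mult_left_mono power_mono) auto
        also have "\<dots> = K * norm (y - x) * norm (y - x)"
          by (simp add: K_def power2_eq_square)
        also have "\<dots> \<le> e * norm (y - x)"
        proof (rule mult_right_mono)
          have "K * norm (y - x) \<le> K * (e / (K + 1))"
            using y d K by (intro mult_left_mono) auto
          also have "\<dots> \<le> e"
            using K e by (simp add: field_simps)
          finally show "K * norm (y - x) \<le> e" .
        qed simp
        finally show ?thesis .
      qed
      then show "\<exists>d>0. \<forall>y. norm (y - x) < d \<longrightarrow>
          norm (H y - ?L y - (H x - ?L x) - 0) \<le> e * norm (y - x)"
        using d(1) by blast
    qed (rule bounded_linear_zero)
    show ?thesis
      using has_derivative_add[OF 1 2] by simp
  qed
  have "Ck_on 1 B1 H"
  proof (rule Ck_1I[OF Hder])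
    show "continuous_on B1 (\<lambda>x. - (H x o\<^sub>L G' x v o\<^sub>L H x))" for v
      by (intro continuous_on_minus bounded_bilinear.continuous_on[OF bounded_bilinear_blinfun_compose]
          Hcont continuous_on_subset[OF G'(2) B1(3)])
  qed
  with that B1 HG GH show thesis by blast
qed

text \<open>The transpose of \<open>A\<close>. The sum over the basis makes it a bounded operator by
  construction and visibly linear in \<open>A\<close>, so that derivatives pass through it.\<close>

definition blinfun_adjoint ::
    "('x::euclidean_space \<Rightarrow>\<^sub>L 'y::euclidean_space) \<Rightarrow> ('y \<Rightarrow>\<^sub>L 'x)" where
  "blinfun_adjoint A = (\<Sum>b\<in>Basis. blinfun_scaleR_left b o\<^sub>L blinfun_inner_right (A b))"

lemma inner_blinfun_adjoint: "x \<bullet> blinfun_adjoint A y = A x \<bullet> y"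
proof -
  have "A x \<bullet> y = A (\<Sum>b\<in>Basis. (x \<bullet> b) *\<^sub>R b) \<bullet> y"
    by (simp add: euclidean_representation)
  then show ?thesis
    by (simp add: blinfun_adjoint_def blinfun.sum_left blinfun.sum_right blinfun.scaleR_right
        inner_sum_left inner_sum_right mult.commute)
qed

lemma bounded_linear_blinfun_adjoint: "bounded_linear blinfun_adjoint"
  unfolding blinfun_adjoint_def
  by (intro bounded_linear_sum
      bounded_linear_compose[OF bounded_bilinear.bounded_linear_right[OF bounded_bilinear_blinfun_compose]]
      bounded_linear_compose[OF bounded_linear_blinfun_inner_right] blinfun.bounded_linear_left)

lemma blinfun_projection_exists:
  fixes V :: "'y::euclidean_space set"
  assumes "subspace V"
  obtains P :: "'y \<Rightarrow>\<^sub>L 'y" where "\<And>v. P v \<in> V" "\<And>v. v \<in> V \<Longrightarrow> P v = v"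
proof -
  have span: "span V = V" using assms by (simp add: span_eq_iff)
  obtain g where g: "range g \<subseteq> V" "linear g" "\<And>v. v \<in> V \<Longrightarrow> g v = v"
    using linear_inj_on_left_inverse[OF bounded_linear.linear[OF bounded_linear_ident], of V]
    unfolding span by auto
  have "blinfun_apply (Blinfun g) = g"
    using g(2) by (intro bounded_linear_Blinfun_apply) (simp add: linear_conv_bounded_linear)
  with that g show thesis by (metis rangeI subsetD)
qed

subsection \<open>Involutive distributions of constant rank\<close>

text \<open>\<open>P\<close> projects onto the range of \<open>J x0\<close>. The field \<open>A\<close> lifts \<open>v\<close> to the vector in the
  distribution \<open>range (J x)\<^sup>T\<close> whose image under \<open>P \<circ> J x\<close> is \<open>P v\<close>; as the lifts have constant
  images, their brackets lie in the kernel of \<open>P \<circ> J x\<close>, and involutivity forces them to vanish.\<close>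

lemma involutive_flat_field:
  fixes \<phi> :: "'x::euclidean_space \<Rightarrow> 'y::euclidean_space" and J :: "'x \<Rightarrow> 'x \<Rightarrow>\<^sub>L 'y"
    and J' :: "'x \<Rightarrow> 'x \<Rightarrow>\<^sub>L 'x \<Rightarrow>\<^sub>L 'y"
  assumes \<Omega>: "open \<Omega>" "x0 \<in> \<Omega>"
    and \<phi>: "\<And>x. x \<in> \<Omega> \<Longrightarrow> (\<phi> has_derivative J x) (at x)"
    and C1: "Ck_on 1 \<Omega> J" and J': "\<And>x. x \<in> \<Omega> \<Longrightarrow> (J has_derivative J' x) (at x)"
    and rk: "\<And>x. x \<in> \<Omega> \<Longrightarrow> dim (range (blinfun_adjoint (J x))) = dim (range (J x0))"
    and inv: "\<And>x a b. x \<in> \<Omega> \<Longrightarrow>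
      blinfun_adjoint (J' x (blinfun_adjoint (J x) b)) a - blinfun_adjoint (J' x (blinfun_adjoint (J x) a)) b
        \<in> range (blinfun_adjoint (J x))"
  obtains B and P :: "'y \<Rightarrow>\<^sub>L 'y" and A :: "'x \<Rightarrow> 'y \<Rightarrow>\<^sub>L 'x" and A' :: "'x \<Rightarrow> 'x \<Rightarrow>\<^sub>L 'y \<Rightarrow>\<^sub>L 'x"
  where "open B" "x0 \<in> B" "B \<subseteq> \<Omega>"
    "\<And>x w. \<lbrakk>x \<in> B; w \<in> range (blinfun_adjoint (J x))\<rbrakk> \<Longrightarrow> A x (P (J x w)) = w"
    "\<And>x. x \<in> B \<Longrightarrow> (A has_derivative A' x) (at x)" "continuous_on B A'"
    "\<And>x v k. x \<in> B \<Longrightarrow> A' x (A x v) k = A' x (A x k) v"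
proof -
  define Jt where "Jt x = blinfun_adjoint (J x)" for x
  have inner_Jt: "w \<bullet> Jt x y = J x w \<bullet> y" for w x y
    unfolding Jt_def by (rule inner_blinfun_adjoint)
  have lin1: "linear (blinfun_apply T)" for T :: "'y \<Rightarrow>\<^sub>L 'x"
    by (intro bounded_linear.linear blinfun.bounded_linear_right)
  have lin2: "linear (blinfun_apply T)" for T :: "'y \<Rightarrow>\<^sub>L 'y"
    by (intro bounded_linear.linear blinfun.bounded_linear_right)
  define V where "V = range (J x0)"
  have V: "subspace V"
    unfolding V_def
    by (intro linear_subspace_image bounded_linear.linear blinfun.bounded_linear_right) simp
  obtain P :: "'y \<Rightarrow>\<^sub>L 'y" where P: "\<And>v. P v \<in> V" "\<And>v. v \<in> V \<Longrightarrow> P v = v"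
    using blinfun_projection_exists[OF V] by blast
  have PP: "P (P v) = P v" for v
    by (rule P(2)[OF P(1)])
  \<comment> \<open>On \<open>V\<close> this is \<open>P J J^T\<close>, the map to be inverted; on
    the kernel of \<open>P\<close> it is the identity. The extension turns it into an endomorphism
    of the whole space, whose inverse depends on \<open>x\<close> in a \<open>C^1\<close>
    way.\<close>
  define G where "G x = (P o\<^sub>L (J x o\<^sub>L (Jt x o\<^sub>L P))) + (id_blinfun - P)" for x
  have G_apply: "G x v = P (J x (Jt x (P v))) + v - P v" for x v
    by (simp add: G_def blinfun.bilinear_simps id_blinfun.rep_eq)
  have C1t: "Ck_on 1 \<Omega> Jt"
    unfolding Jt_def[abs_def] by (rule Ck_1_bounded_linear[OF bounded_linear_blinfun_adjoint C1])
  note comp = Ck_1_bilinear[OF bounded_bilinear_blinfun_compose]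
  have C1G: "Ck_on 1 \<Omega> G"
    unfolding G_def[abs_def] by (intro Ck_1_add comp Ck_1_const C1 C1t)
  \<comment> \<open>A vector in the kernel is shown to lie in the range of \<open>J x0\<close> and
    to be annihilated by \<open>Jt x0\<close>, hence to be orthogonal to that range and so to
    itself.\<close>
  have "inj (G x0)"
  proof (rule linear_injective_0[OF lin2, THEN iffD2], intro allI impI)
    fix v assume 0: "G x0 v = 0"
    have "P (G x0 v) = P (J x0 (Jt x0 (P v)))"
      by (simp add: G_apply blinfun.add_right blinfun.diff_right PP)
    then have 1: "J x0 (Jt x0 (P v)) = 0"
      using 0 P(2)[of "J x0 (Jt x0 (P v))"] by (simp add: V_def blinfun.zero_right)
    then have v: "P v = v"
      using 0 by (simp add: G_apply blinfun.zero_right)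
    have "Jt x0 v \<bullet> Jt x0 v = 0"
      using 1 by (simp add: inner_Jt v)
    then have "Jt x0 v = 0" by simp
    moreover obtain w where "v = J x0 w"
      using P(1)[of v] v by (auto simp: V_def)
    ultimately have "v \<bullet> v = 0"
      using inner_Jt[of w x0 v] by simp
    then show "v = 0" by simp
  qed
  with \<Omega> C1G obtain B and H :: "'x \<Rightarrow> 'y \<Rightarrow>\<^sub>L 'y" where B: "open B" "x0 \<in> B" "B \<subseteq> \<Omega>"
    and C1H: "Ck_on 1 B H"
    and HG: "\<And>x v. x \<in> B \<Longrightarrow> H x (G x v) = v" and GH: "\<And>x v. x \<in> B \<Longrightarrow> G x (H x v) = v"
    by (rule Ck_1_blinfun_inverse) blast
  \<comment> \<open>Here the constant rank enters: \<open>Jt x\<close> is injective on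
    \<open>V\<close> because \<open>G x\<close> is, and equality of dimensions makes the image of
    \<open>V\<close> the full range of \<open>Jt x\<close>.\<close>
  have range_Jt: "\<exists>p. w = Jt x p \<and> P p = p" if x: "x \<in> B" and w: "w \<in> range (Jt x)" for x w
  proof -
    have "inj_on (Jt x) V"
    proof (rule linear_injective_on_subspace_0[OF lin1 V, THEN iffD2], intro ballI impI)
      fix p assume "p \<in> V" "Jt x p = 0"
      then have "G x p = 0" by (simp add: G_apply P blinfun.zero_right)
      then show "p = 0" using HG[OF x, of p] by (simp add: blinfun.zero_right)
    qed
    then have "dim (Jt x ` V) = dim V"
      using V by (intro dim_image_eq lin1) (simp add: span_eq_iff[THEN iffD2])
    also have "\<dots> = dim (range (Jt x))"
      using rk[of x] B(3) x by (auto simp: V_def Jt_def)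
    finally have "Jt x ` V = range (Jt x)"
      using V by (intro subspace_dim_equal linear_subspace_image lin1) auto
    then show ?thesis
      using w P(2) by force
  qed
  define A where "A x = Jt x o\<^sub>L (P o\<^sub>L H x)" for x
  have A_apply: "A x v = Jt x (P (H x v))" for x v
    by (simp add: A_def)
  have C1A: "Ck_on 1 B A"
    unfolding A_def[abs_def] by (intro comp Ck_1_const C1H Ck_on_subset[OF C1t B(3)])
  have A_lift: "A x (P (J x w)) = w" if x: "x \<in> B" and w: "w \<in> range (Jt x)" for x w
  proof -
    obtain p where p: "w = Jt x p" "P p = p" using range_Jt[OF x w] by blast
    then have "P (J x w) = G x p" by (simp add: G_apply)
    then show ?thesis using p HG[OF x] by (simp add: A_apply)
  qed
  have PJA: "P (J x (A x v)) = P v" if x: "x \<in> B" for x v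
  proof -
    have "P (J x (A x v)) = G x (H x v) - (H x v - P (H x v))"
      by (simp add: A_apply G_apply)
    also have "\<dots> = v - (H x v - P (H x v))"
      using GH[OF x] by simp
    finally have "P (P (J x (A x v))) = P v"
      by (simp add: blinfun.add_right blinfun.diff_right PP)
    then show ?thesis by (simp add: PP)
  qed
  obtain A' :: "'x \<Rightarrow> 'x \<Rightarrow>\<^sub>L 'y \<Rightarrow>\<^sub>L 'x" where A': "\<And>x. x \<in> B \<Longrightarrow> (A has_derivative A' x) (at x)"
    and A'c: "continuous_on B A'"
    using C1A by (rule Ck_1_imp_C1) blast
  obtain H' where H': "\<And>x. x \<in> B \<Longrightarrow> (H has_derivative H' x) (at x)"
    using C1H by (rule Ck_1E) blast
  have flat: "A' x (A x v) k = A' x (A x k) v" if x: "x \<in> B" for x v k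
  proof -
    have x\<Omega>: "x \<in> \<Omega>" using x B by blast
    \<comment> \<open>Product rule. The second summand lies in \<open>range (Jt x)\<close>, so
      modulo the distribution only the derivative of \<open>Jt\<close> counts.\<close>
    have A'_apply: "A' x h u = blinfun_adjoint (J' x h) (P (H x u)) + Jt x (P (H' x h u))" for h u
    proof -
      have 1: "(Jt has_derivative (\<lambda>h. blinfun_adjoint (J' x h))) (at x)"
        unfolding Jt_def[abs_def]
        by (rule bounded_linear.has_derivative[OF bounded_linear_blinfun_adjoint J'[OF x\<Omega>]])
      have 2: "((\<lambda>x. P o\<^sub>L H x) has_derivative (\<lambda>h. P o\<^sub>L H' x h)) (at x)"
        by (rule bounded_linear.has_derivative[OF
              bounded_bilinear.bounded_linear_right[OF bounded_bilinear_blinfun_compose] H'[OF x]])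
      have "(A has_derivative (\<lambda>h. (Jt x o\<^sub>L (P o\<^sub>L H' x h)) + (blinfun_adjoint (J' x h) o\<^sub>L (P o\<^sub>L H x)))) (at x)"
        unfolding A_def[abs_def]
        by (rule bounded_bilinear.FDERIV[OF bounded_bilinear_blinfun_compose 1 2])
      from has_derivative_unique[OF A'[OF x] this]
      show ?thesis by (metis (no_types, lifting) add.commute blinfun.add_left blinfun_apply_blinfun_compose)
    qed
    \<comment> \<open>Derivative of \<open>P (J y (A y u))\<close>, which is constantly
      \<open>P u\<close> on \<open>B\<close>.\<close>
    have dPJA: "P (J' x h (A x u)) + P (J x (A' x h u)) = 0" for h u
    proof -
      have 1: "((\<lambda>y. A y u) has_derivative (\<lambda>h. A' x h u)) (at x)"
        by (rule bounded_linear.has_derivative[OF blinfun.bounded_linear_left A'[OF x]])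
      have "((\<lambda>y. J y (A y u)) has_derivative (\<lambda>h. J x (A' x h u) + J' x h (A x u))) (at x)"
        by (rule bounded_bilinear.FDERIV[OF bounded_bilinear_blinfun_apply J'[OF x\<Omega>] 1])
      then have "((\<lambda>y. P (J y (A y u))) has_derivative (\<lambda>h. P (J x (A' x h u) + J' x h (A x u)))) (at x)"
        by (rule bounded_linear.has_derivative[OF blinfun.bounded_linear_right])
      moreover have "((\<lambda>y. P (J y (A y u))) has_derivative (\<lambda>h. 0)) (at x)"
        by (rule has_derivative_transform_within_open[OF has_derivative_const[of "P u"] B(1) x])
          (simp add: PJA)
      ultimately have "(\<lambda>h. P (J x (A' x h u) + J' x h (A x u))) = (\<lambda>h. 0)"
        by (rule has_derivative_unique)
      then show ?thesis
        by (metis (no_types, lifting) add.commute blinfun.add_right)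
    qed
    \<comment> \<open>The bracket of the lifts of \<open>k\<close> and \<open>v\<close>. It is
      placed both in \<open>range (Jt x)\<close> and in the kernel of \<open>P\<close> after
      \<open>J x\<close>, and \<open>A_lift\<close> shows that these meet only in 0.\<close>
    define w where "w = A' x (A x v) k - A' x (A x k) v"
    have "w \<in> range (Jt x)"
    proof -
      \<comment> \<open>Modulo \<open>range (Jt x)\<close> the bracket equals that of the gradient
        fields whose constant coefficients are the values \<open>?a\<close> and \<open>?b\<close>
        frozen at \<open>x\<close>; involutivity applies to those.\<close>
      let ?a = "P (H x v)" and ?b = "P (H x k)"
      obtain p where p: "blinfun_adjoint (J' x (Jt x ?a)) ?b - blinfun_adjoint (J' x (Jt x ?b)) ?a = Jt x p"
        using inv[OF x\<Omega>, where b = ?a and a = ?b] unfolding Jt_def by blast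
      have "w = Jt x (p + P (H' x (A x v) k) - P (H' x (A x k) v))"
        unfolding w_def A'_apply blinfun.add_right blinfun.diff_right p[symmetric]
        by (simp add: A_apply)
      then show ?thesis by blast
    qed
    moreover have "P (J x w) = 0"
    proof -
      \<comment> \<open>By \<open>dPJA\<close>, the image of \<open>w\<close> is a difference of
        second derivatives of \<open>\<phi>\<close> with exchanged arguments.\<close>
      have "J' x (A x v) (A x k) = J' x (A x k) (A x v)"
        using \<Omega>(1) x\<Omega> \<phi> J'[OF x\<Omega>] by (rule second_derivative_symmetric)
      moreover have "P (J x (A' x h u)) = - P (J' x h (A x u))" for h u
        using dPJA[of h u] by (simp add: eq_neg_iff_add_eq_0 add.commute)
      ultimately show ?thesis
        by (simp add: w_def blinfun.diff_right)
    qed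
    ultimately have "w = 0"
      using A_lift[OF x, of w] by (simp add: blinfun.zero_right)
    then show ?thesis by (simp add: w_def)
  qed
  show thesis
    by (rule that[OF B _ A' A'c flat]) (use A_lift in \<open>auto simp: Jt_def\<close>)
qed

text \<open>Tangency and the lift property show that \<open>\<gamma>\<close> has velocity
  \<open>A (\<gamma> t) (c' t)\<close> for the projected curve \<open>c\<close>, so the integral map
  recovers it. The order of quantifiers matters: \<open>F\<close> is fixed before the curve, while
  \<open>\<tau>'\<close> may depend on the curve.\<close>

lemma horizontal_curves_determined:
  fixes \<phi> :: "'x::euclidean_space \<Rightarrow> 'y::euclidean_space" and J :: "'x \<Rightarrow> 'x \<Rightarrow>\<^sub>L 'y"
    and J' :: "'x \<Rightarrow> 'x \<Rightarrow>\<^sub>L 'x \<Rightarrow>\<^sub>L 'y"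
  assumes \<Omega>: "open \<Omega>" "x0 \<in> \<Omega>"
    and \<phi>: "\<And>x. x \<in> \<Omega> \<Longrightarrow> (\<phi> has_derivative J x) (at x)"
    and C1: "Ck_on 1 \<Omega> J" and J': "\<And>x. x \<in> \<Omega> \<Longrightarrow> (J has_derivative J' x) (at x)"
    and rk: "\<And>x. x \<in> \<Omega> \<Longrightarrow> dim (range (blinfun_adjoint (J x))) = dim (range (J x0))"
    and inv: "\<And>x a b. x \<in> \<Omega> \<Longrightarrow>
      blinfun_adjoint (J' x (blinfun_adjoint (J x) b)) a - blinfun_adjoint (J' x (blinfun_adjoint (J x) a)) b
        \<in> range (blinfun_adjoint (J x))"
  shows "\<exists>F. \<forall>\<tau> \<gamma> \<gamma>' C. 0 < \<tau> \<and> \<gamma> 0 = x0 \<and>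
    (\<forall>t\<in>{0..\<tau>}. \<gamma> t \<in> \<Omega> \<and> (\<gamma> has_vector_derivative \<gamma>' t) (at t within {0..\<tau>}) \<and>
       \<gamma>' t \<in> range (blinfun_adjoint (J (\<gamma> t))) \<and> norm (\<gamma>' t) \<le> C) \<longrightarrow>
    (\<exists>\<tau>'. 0 < \<tau>' \<and> \<tau>' \<le> \<tau> \<and> (\<forall>t\<in>{0..\<tau>'}. F (\<phi> (\<gamma> t)) = \<gamma> t))"
proof -
  obtain B and P :: "'y \<Rightarrow>\<^sub>L 'y" and A :: "'x \<Rightarrow> 'y \<Rightarrow>\<^sub>L 'x" and A' :: "'x \<Rightarrow> 'x \<Rightarrow>\<^sub>L 'y \<Rightarrow>\<^sub>L 'x"
    where B: "open B" "x0 \<in> B" "B \<subseteq> \<Omega>"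
      and lift: "\<And>x w. \<lbrakk>x \<in> B; w \<in> range (blinfun_adjoint (J x))\<rbrakk> \<Longrightarrow> A x (P (J x w)) = w"
      and A': "\<And>x. x \<in> B \<Longrightarrow> (A has_derivative A' x) (at x)" "continuous_on B A'"
      and flat: "\<And>x v k. x \<in> B \<Longrightarrow> A' x (A x v) k = A' x (A x k) v"
    using \<Omega> \<phi> C1 J' rk inv by (rule involutive_flat_field) blast+
  obtain r F where r: "0 < r" and F0: "F 0 = x0"
    and "\<And>y. y \<in> ball 0 r \<Longrightarrow> F y \<in> B"
    and Fder: "\<And>y. y \<in> ball 0 r \<Longrightarrow> (F has_derivative A (F y)) (at y)"
    using B(1,2) A' flat by (rule flat_field_integral_map) blast+
  show ?thesis
  proof (intro exI[of _ "\<lambda>z. F (P (z - \<phi> x0))"] allI impI, elim conjE)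
    fix \<tau> C :: real and \<gamma> \<gamma>' :: "real \<Rightarrow> 'x"
    assume \<tau>: "0 < \<tau>" and \<gamma>0: "\<gamma> 0 = x0"
      and \<gamma>: "\<forall>t\<in>{0..\<tau>}. \<gamma> t \<in> \<Omega> \<and> (\<gamma> has_vector_derivative \<gamma>' t) (at t within {0..\<tau>}) \<and>
       \<gamma>' t \<in> range (blinfun_adjoint (J (\<gamma> t))) \<and> norm (\<gamma>' t) \<le> C"
    have cont: "continuous_on {0..\<tau>} \<gamma>"
      using \<gamma> has_vector_derivative_continuous continuous_on_eq_continuous_within by blast
    have "(\<gamma> \<longlongrightarrow> x0) (at 0 within {0..\<tau>})"
      using cont \<tau> \<gamma>0 unfolding continuous_on_def by fastforce
    then have "\<forall>\<^sub>F t in at 0 within {0..\<tau>}. \<gamma> t \<in> B"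
      using topological_tendstoD[OF _ B(1,2)] by blast
    then obtain d where d: "0 < d" "\<And>t. \<lbrakk>t \<in> {0..\<tau>}; t \<noteq> 0; dist t 0 < d\<rbrakk> \<Longrightarrow> \<gamma> t \<in> B"
      unfolding eventually_at by blast
    \<comment> \<open>The time is shortened so that the curve stays in \<open>B\<close>, where the
      flat fields are defined.\<close>
    define \<sigma> where "\<sigma> = min \<tau> (d / 2)"
    have \<sigma>: "0 < \<sigma>" "\<sigma> \<le> \<tau>" "\<sigma> < d" using \<tau> d by (auto simp: \<sigma>_def)
    then have sub: "{0..\<sigma>} \<subseteq> {0..\<tau>}" by auto
    have inB: "\<gamma> t \<in> B" if "t \<in> {0..\<sigma>}" for t
      using d(2)[of t] that \<sigma> \<gamma>0 B(2) by (cases "t = 0") auto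
    have der: "(\<gamma> has_vector_derivative \<gamma>' t) (at t within {0..\<sigma>})" if "t \<in> {0..\<sigma>}" for t
      using \<gamma> that sub has_vector_derivative_within_subset by blast
    define c where "c t = P (\<phi> (\<gamma> t) - \<phi> x0)" for t
    define c' where "c' t = P (J (\<gamma> t) (\<gamma>' t))" for t
    have "continuous_on {0..\<sigma>} (\<lambda>t. J (\<gamma> t))"
      using sub \<gamma> by (intro continuous_on_compose2[OF Ck_1_continuous_on[OF C1] continuous_on_subset[OF cont sub]]) auto
    then have "bounded ((\<lambda>t. J (\<gamma> t)) ` {0..\<sigma>})"
      by (intro compact_imp_bounded compact_continuous_image) auto
    then obtain K where K: "\<And>t. t \<in> {0..\<sigma>} \<Longrightarrow> norm (J (\<gamma> t)) \<le> K"
      unfolding bounded_iff by blast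
    have "norm (J (\<gamma> 0)) \<le> K" using K \<sigma> by simp
    then have K0: "0 \<le> K" using norm_ge_zero order_trans by blast
    have c0: "c 0 = 0"
      using \<gamma>0 by (simp add: c_def blinfun.zero_right)
    have cder: "(c has_vector_derivative c' t) (at t within {0..\<sigma>})" if t: "t \<in> {0..\<sigma>}" for t
    proof -
      have "((\<lambda>t. \<phi> (\<gamma> t)) has_vector_derivative J (\<gamma> t) (\<gamma>' t)) (at t within {0..\<sigma>})"
        by (rule has_vector_derivative_blinfun_compose[OF der[OF t]]) (use \<phi> inB[OF t] B(3) in auto)
      then have "((\<lambda>t. \<phi> (\<gamma> t) - \<phi> x0) has_vector_derivative J (\<gamma> t) (\<gamma>' t)) (at t within {0..\<sigma>})"
        by (simp add: has_vector_derivative_diff_const)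
      then show ?thesis
        unfolding c_def[abs_def] c'_def
        by (rule bounded_linear.has_vector_derivative[OF blinfun.bounded_linear_right])
    qed
    have gder: "(\<gamma> has_vector_derivative A (\<gamma> t) (c' t)) (at t within {0..\<sigma>})" if t: "t \<in> {0..\<sigma>}" for t
    proof -
      have "A (\<gamma> t) (c' t) = \<gamma>' t"
        unfolding c'_def by (rule lift[OF inB[OF t]]) (use \<gamma> t sub in auto)
      then show ?thesis using der[OF t] by simp
    qed
    have bd: "norm (c' t) \<le> norm P * (K * C)" if t: "t \<in> {0..\<sigma>}" for t
    proof -
      have "norm (c' t) \<le> norm P * norm (J (\<gamma> t) (\<gamma>' t))"
        unfolding c'_def by (rule norm_blinfun)
      also have "\<dots> \<le> norm P * (norm (J (\<gamma> t)) * norm (\<gamma>' t))"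
        by (intro mult_left_mono norm_blinfun) auto
      also have "\<dots> \<le> norm P * (K * C)"
        using K[OF t] K0 \<gamma> t sub by (intro mult_left_mono mult_mono) auto
      finally show ?thesis .
    qed
    obtain \<tau>' where "0 < \<tau>'" "\<tau>' \<le> \<sigma>" "\<And>t. t \<in> {0..\<tau>'} \<Longrightarrow> \<gamma> t = F (c t)"
      using B(1,2) A' r F0 Fder \<sigma>(1) c0 \<gamma>0 cder gder bd by (rule flat_field_lift) blast+
    then show "\<exists>\<tau>'. 0 < \<tau>' \<and> \<tau>' \<le> \<tau> \<and> (\<forall>t\<in>{0..\<tau>'}. F (P (\<phi> (\<gamma> t) - \<phi> x0)) = \<gamma> t)"
      using \<sigma>(2) by (intro exI[of _ \<tau>']) (auto simp: c_def)
  qed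
qed

subsection \<open>Gradient flows\<close>

lemma Ck_2_imp_Ck_1:
  assumes "Ck_on 2 S f"
  shows "Ck_on 1 S f"
proof -
  have "continuous_on S (\<lambda>x. frechet_derivative f (at x) v)" for v
    by (rule Ck_1_continuous_on) (use assms in \<open>simp add: numeral_2_eq_2\<close>)
  then show ?thesis
    using assms by (simp add: numeral_2_eq_2)
qed

lemma Ck_1_compose:
  fixes p :: "'y::euclidean_space \<Rightarrow> 'z::real_normed_vector" and q :: "'x::euclidean_space \<Rightarrow> 'y"
  assumes "Ck_on 1 T p" "Ck_on 1 S q" "q ` S \<subseteq> T"
  shows "Ck_on 1 S (\<lambda>x. p (q x))"
proof -
  obtain p' :: "'y \<Rightarrow> 'y \<Rightarrow>\<^sub>L 'z"
    where p: "\<And>y. y \<in> T \<Longrightarrow> (p has_derivative p' y) (at y)" "continuous_on T p'"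
    using assms(1) by (rule Ck_1_imp_C1) blast
  obtain q' where q: "\<And>x. x \<in> S \<Longrightarrow> (q has_derivative q' x) (at x)"
    "\<And>v. continuous_on S (\<lambda>x. q' x v)" using assms(2) by (rule Ck_1E) blast
  show ?thesis
  proof (rule Ck_1I[where f' = "\<lambda>x v. p' (q x) (q' x v)"])
    fix x assume x: "x \<in> S"
    then have "q x \<in> T" using assms(3) by blast
    then show "((\<lambda>x. p (q x)) has_derivative (\<lambda>v. p' (q x) (q' x v))) (at x)"
      by (rule has_derivative_compose[OF q(1)[OF x] p(1)])
  next
    fix v
    have "continuous_on S (\<lambda>x. p' (q x))"
      using p(2) Ck_1_continuous_on[OF assms(2)] assms(3) by (rule continuous_on_compose2)
    then show "continuous_on S (\<lambda>x. p' (q x) (q' x v))"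
      using q(2) by (rule blinfun.continuous_on)
  qed
qed

section \<open>Gradients and Jacobian matrices in terms of bounded operators and their
  adjoints\<close>

lemma gradient_eqI:
  assumes "(f has_derivative (\<lambda>h. h \<bullet> w)) (at x)"
  shows "gradient f x = w"
  unfolding gradient_def
proof (rule the_equality)
  show "GDERIV f x :> w"
    using assms by (simp add: gderiv_def)
  fix D assume "GDERIV f x :> D"
  then have "(\<lambda>h. h \<bullet> D) = (\<lambda>h. h \<bullet> w)"
    using assms has_derivative_unique unfolding gderiv_def by blast
  then show "D = w"
    by (simp add: fun_eq_iff vector_eq_ldot)
qed

lemma gradient_blinfun:
  assumes "(f has_derivative blinfun_apply L) (at x)"
  shows "gradient f x = blinfun_adjoint L 1"
  using assms by (intro gradient_eqI) (simp add: inner_blinfun_adjoint)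

lemma jacobian_apply:
  fixes f :: "real^'a \<Rightarrow> real^'b"
  assumes "(f has_derivative D) (at x)"
  shows "jacobian f (at x) *v h = D h"
proof -
  have "(f has_derivative (\<lambda>h. jacobian f (at x) *v h)) (at x)"
    using assms jacobian_works differentiableI by blast
  then show ?thesis
    using has_derivative_unique[OF assms] by (simp add: fun_eq_iff)
qed

lemma transpose_jacobian_apply:
  fixes f :: "real^'a \<Rightarrow> real^'b"
  assumes "(f has_derivative blinfun_apply L) (at x)"
  shows "transpose (jacobian f (at x)) *v y = blinfun_adjoint L y"
proof -
  have "(y v* jacobian f (at x)) \<bullet> h = y \<bullet> L h" for h
    by (simp add: dot_lmul_matrix jacobian_apply[OF assms])
  then have "h \<bullet> (transpose (jacobian f (at x)) *v y) = h \<bullet> blinfun_adjoint L y" for h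
    by (simp add: inner_blinfun_adjoint inner_commute)
  then show ?thesis using vector_eq_ldot by blast
qed

lemma sym_psd_mult_transpose: "sym_psd (A ** transpose A)"
  by (simp add: sym_psd_def matrix_transpose_mul matrix_vector_mul_assoc[symmetric]
      dot_lmul_matrix[symmetric])

text \<open>The gradient of the \<open>j\<close>-th coordinate is the adjoint at the
  \<open>j\<close>-th unit vector. This matches the fields of the hypothesis with the operator form
  used for distributions.\<close>

lemma gradient_field_eq:
  fixes \<phi> :: "real^'D \<Rightarrow> real^'d"
  assumes "(\<phi> has_derivative blinfun_apply L) (at \<theta>)"
  shows "(\<Sum>j\<in>UNIV. c $ j *\<^sub>R gradient (\<lambda>\<eta>. \<phi> \<eta> $ j) \<theta>) = blinfun_adjoint L c"
proof -
  have "gradient (\<lambda>\<eta>. \<phi> \<eta> $ j) \<theta> = blinfun_adjoint L (axis j 1)" for j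
  proof (rule gradient_eqI)
    show "((\<lambda>\<eta>. \<phi> \<eta> $ j) has_derivative (\<lambda>h. h \<bullet> blinfun_adjoint L (axis j 1))) (at \<theta>)"
      using bounded_linear.has_derivative[OF bounded_linear_vec_nth assms, of j]
      by (simp add: inner_blinfun_adjoint inner_axis)
  qed
  then have "(\<Sum>j\<in>UNIV. c $ j *\<^sub>R gradient (\<lambda>\<eta>. \<phi> \<eta> $ j) \<theta>)
      = blinfun_adjoint L (\<Sum>j\<in>UNIV. c $ j *\<^sub>R axis j 1)"
    by (simp add: blinfun.sum_right blinfun.scaleR_right)
  then show ?thesis
    using basis_expansion[of c] by (simp add: scalar_mult_eq_scaleR)
qed

theorem proposition3p7:
  fixes \<Theta> \<Omega> :: "(real^'D) set" and \<phi> :: "real^'D \<Rightarrow> real^'d"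
  assumes "open \<Theta>" and "open \<Omega>" and "\<Omega> \<subseteq> \<Theta>"
    and "smooth_on \<Theta> \<phi>"
    and "(\<lambda>\<theta>. rank (jacobian \<phi> (at \<theta>))) constant_on \<Omega>"
    and "\<And>\<chi>1 \<chi>2 \<theta>. \<lbrakk>\<chi>1 \<in> gradient_fields \<phi>; \<chi>2 \<in> gradient_fields \<phi>; \<theta> \<in> \<Omega>\<rbrakk> \<Longrightarrow>
           lie_bracket \<chi>1 \<chi>2 \<theta> \<in> gradient_fields_at \<phi> \<theta>"
  shows "\<exists>M :: real^'d \<Rightarrow> real^'D \<Rightarrow> real^'d^'d.
    (\<forall>z. \<forall>\<theta>init\<in>\<Omega>. sym_psd (M z \<theta>init)) \<and>
    (\<forall>(g :: real^'D \<Rightarrow> real^'m \<Rightarrow> real^'n) (l :: real^'n \<Rightarrow> 'y \<Rightarrow> real) N X Y.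
       (\<forall>y. Ck_on 2 UNIV (\<lambda>z. l z y)) \<longrightarrow>
       (\<forall>i<N. Ck_on 2 \<Omega> (\<lambda>\<theta>. g \<theta> (X i))) \<longrightarrow>
       reparametrizes \<Omega> \<phi> g (X ` {..<N}) \<longrightarrow>
       (\<forall>\<theta>init\<in>\<Omega>. \<forall>\<theta> T U V ft.
          maximal_ivp_solution \<Omega> (\<lambda>\<eta>. - gradient (data_cost l g N X Y) \<eta>) \<theta>init T \<theta> \<longrightarrow>
          factors_locally \<Omega> \<phi> g (X ` {..<N}) \<theta>init U V ft \<longrightarrow>
          (\<exists>Tstar. 0 < Tstar \<and> Tstar \<le> T \<and>
             ivp_solution V (\<lambda>z. - (M z \<theta>init *v gradient (data_cost l ft N X Y) z))
               (\<phi> \<theta>init) Tstar (\<lambda>t. \<phi> (\<theta> t)))))"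
proof -
  have C2: "Ck_on 2 \<Omega> \<phi>"
    using assms(3,4) Ck_on_subset unfolding smooth_on_def by blast
  obtain J :: "real^'D \<Rightarrow> (real^'D) \<Rightarrow>\<^sub>L (real^'d)"
    where \<phi>: "\<And>x. x \<in> \<Omega> \<Longrightarrow> (\<phi> has_derivative J x) (at x)" and C1J: "Ck_on 1 \<Omega> J"
    using C2 by (rule Ck_1_frechet_derivative_blinfun) blast
  obtain J' :: "real^'D \<Rightarrow> (real^'D) \<Rightarrow>\<^sub>L (real^'D) \<Rightarrow>\<^sub>L (real^'d)"
    where J': "\<And>x. x \<in> \<Omega> \<Longrightarrow> (J has_derivative J' x) (at x)"
    using C1J by (rule Ck_1_imp_C1) blast
  let ?Jt = "\<lambda>x. blinfun_adjoint (J x)"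
  \<comment> \<open>Row rank equals column rank, which lets the dimension at one point be compared
    with that of \<open>range (J y)\<close> at another.\<close>
  have rk: "dim (range (?Jt x)) = dim (range (J y))" if "x \<in> \<Omega>" "y \<in> \<Omega>" for x y
  proof -
    have "dim (range (?Jt x)) = rank (transpose (jacobian \<phi> (at x)))"
      unfolding rank_dim_range transpose_jacobian_apply[OF \<phi>[OF that(1)]] ..
    also have "\<dots> = rank (jacobian \<phi> (at y))"
      unfolding rank_transpose using assms(5) that unfolding constant_on_def by metis
    also have "\<dots> = dim (range (J y))"
      unfolding rank_dim_range jacobian_apply[OF \<phi>[OF that(2)]] ..
    finally show ?thesis .
  qed
  \<comment> \<open>On \<open>\<Omega>\<close> the gradient field with coefficients \<open>c\<close>
    is \<open>?Jt y c\<close>, so its Jacobian at \<open>x\<close> is given by the adjoint of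
    \<open>J'\<close>; and the span of the field values is \<open>range (?Jt x)\<close>
    itself.\<close>
  have inv: "blinfun_adjoint (J' x (?Jt x b)) a - blinfun_adjoint (J' x (?Jt x a)) b \<in> range (?Jt x)"
    if x: "x \<in> \<Omega>" for x a b
  proof -
    define \<xi> where "\<xi> c \<theta> = (\<Sum>j\<in>UNIV. c $ j *\<^sub>R gradient (\<lambda>\<eta>. \<phi> \<eta> $ j) \<theta>)" for c :: "real^'d" and \<theta>
    have \<xi>_eq: "\<xi> c y = ?Jt y c" if "y \<in> \<Omega>" for c y
      unfolding \<xi>_def by (rule gradient_field_eq[OF \<phi>[OF that]])
    have fields: "gradient_fields \<phi> = range \<xi>"
      by (simp add: gradient_fields_def \<xi>_def[abs_def])
    have "(\<xi> c has_derivative (\<lambda>h. blinfun_adjoint (J' x h) c)) (at x)" for c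
    proof (rule has_derivative_transform_within_open[OF _ assms(2) x])
      show "((\<lambda>y. ?Jt y c) has_derivative (\<lambda>h. blinfun_adjoint (J' x h) c)) (at x)"
        by (rule bounded_linear.has_derivative[OF blinfun.bounded_linear_left
              bounded_linear.has_derivative[OF bounded_linear_blinfun_adjoint J'[OF x]]])
    qed (simp add: \<xi>_eq)
    then have "jacobian (\<xi> c) (at x) *v h = blinfun_adjoint (J' x h) c" for c h
      by (rule jacobian_apply)
    then have "lie_bracket (\<xi> a) (\<xi> b) x
        = blinfun_adjoint (J' x (?Jt x b)) a - blinfun_adjoint (J' x (?Jt x a)) b"
      by (simp add: lie_bracket_def \<xi>_eq x)
    moreover have "lie_bracket (\<xi> a) (\<xi> b) x \<in> gradient_fields_at \<phi> x"
      by (rule assms(6)) (auto simp: fields x)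
    moreover have "gradient_fields_at \<phi> x = span (range (?Jt x))"
      by (simp add: gradient_fields_at_def fields image_image \<xi>_eq x)
    moreover have "subspace (range (?Jt x))"
      by (intro linear_subspace_image bounded_linear.linear blinfun.bounded_linear_right) simp
    ultimately show ?thesis
      by (metis span_eq_iff)
  qed
  have "\<exists>F. \<forall>\<tau> \<gamma> \<gamma>' C. 0 < \<tau> \<and> \<gamma> 0 = x0 \<and>
    (\<forall>t\<in>{0..\<tau>}. \<gamma> t \<in> \<Omega> \<and> (\<gamma> has_vector_derivative \<gamma>' t) (at t within {0..\<tau>}) \<and>
       \<gamma>' t \<in> range (?Jt (\<gamma> t)) \<and> norm (\<gamma>' t) \<le> C) \<longrightarrow>
    (\<exists>\<tau>'. 0 < \<tau>' \<and> \<tau>' \<le> \<tau> \<and> (\<forall>t\<in>{0..\<tau>'}. F (\<phi> (\<gamma> t)) = \<gamma> t))" if x0: "x0 \<in> \<Omega>" for x0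
    using assms(2) x0 \<phi> C1J J' rk[OF _ x0] inv by (rule horizontal_curves_determined)
  then obtain F where F: "\<And>x0 \<tau> \<gamma> \<gamma>' C. \<lbrakk>x0 \<in> \<Omega>; 0 < \<tau>; \<gamma> 0 = x0;
      \<forall>t\<in>{0..\<tau>}. \<gamma> t \<in> \<Omega> \<and> (\<gamma> has_vector_derivative \<gamma>' t) (at t within {0..\<tau>}) \<and>
        \<gamma>' t \<in> range (?Jt (\<gamma> t)) \<and> norm (\<gamma>' t) \<le> C\<rbrakk> \<Longrightarrow>
    \<exists>\<tau>'. 0 < \<tau>' \<and> \<tau>' \<le> \<tau> \<and> (\<forall>t\<in>{0..\<tau>'}. F x0 (\<phi> (\<gamma> t)) = \<gamma> t)"
    by metis
  \<comment> \<open>\<open>J J^T\<close> at the parameter recovered from \<open>z\<close> and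
    \<open>x0\<close>. It is built before any model, loss or solution is fixed, and has the form
    \<open>A A^T\<close> even at those \<open>z\<close> where \<open>F x0 z\<close> is not a
    parameter reached by a flow.\<close>
  define M where "M z x0 = jacobian \<phi> (at (F x0 z)) ** transpose (jacobian \<phi> (at (F x0 z)))" for z x0
  show ?thesis
  proof (intro exI[of _ M] conjI allI ballI impI)
    show "sym_psd (M z x0)" for z x0
      unfolding M_def by (rule sym_psd_mult_transpose)
  next
    fix g :: "real^'D \<Rightarrow> real^'m \<Rightarrow> real^'n" and l :: "real^'n \<Rightarrow> 'y \<Rightarrow> real" and N X Y \<theta>init \<theta> T U V ft
    assume l: "\<forall>y. Ck_on 2 UNIV (\<lambda>z. l z y)" and \<theta>init: "\<theta>init \<in> \<Omega>"
      and sol: "maximal_ivp_solution \<Omega> (\<lambda>\<eta>. - gradient (data_cost l g N X Y) \<eta>) \<theta>init T \<theta>"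
      and fac: "factors_locally \<Omega> \<phi> g (X ` {..<N}) \<theta>init U V ft"
    let ?f = "data_cost l ft N X Y"
    have U: "open U" "\<theta>init \<in> U" "U \<subseteq> \<Omega>" and V: "open V" "\<phi> ` U \<subseteq> V"
      and ft: "\<And>i. i < N \<Longrightarrow> Ck_on 2 V (\<lambda>z. ft z (X i))"
      and gft: "\<And>i \<eta>. \<lbrakk>i < N; \<eta> \<in> U\<rbrakk> \<Longrightarrow> g \<eta> (X i) = ft (\<phi> \<eta>) (X i)"
      using fac unfolding factors_locally_def by auto
    have "Ck_on 1 V (\<lambda>z. l (ft z (X i)) (Y i))" if "i < N" for i
      by (rule Ck_1_compose[OF Ck_2_imp_Ck_1[OF l[rule_format]] Ck_2_imp_Ck_1[OF ft[OF that]]]) simp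
    then have "Ck_on 1 V (\<lambda>z. \<Sum>i<N. l (ft z (X i)) (Y i))"
      by (intro Ck_1_sum) (simp del: Ck_on.simps One_nat_def)
    then have "Ck_on 1 V ?f"
      unfolding data_cost_def[abs_def] .
    then obtain f' :: "real^'d \<Rightarrow> (real^'d) \<Rightarrow>\<^sub>L real"
      where f': "\<And>z. z \<in> V \<Longrightarrow> (?f has_derivative f' z) (at z)" and f'c: "continuous_on V f'"
      by (rule Ck_1_imp_C1) blast
    have gradf: "gradient ?f z = blinfun_adjoint (f' z) 1" if "z \<in> V" for z
      by (rule gradient_blinfun[OF f'[OF that]])
    \<comment> \<open>Chain rule. The factorization holds on the open set \<open>U\<close>, which
      suffices to transfer the derivative.\<close>
    have gradE: "gradient (data_cost l g N X Y) \<eta> = ?Jt \<eta> (gradient ?f (\<phi> \<eta>))" if \<eta>: "\<eta> \<in> U" for \<eta>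
    proof (rule gradient_eqI)
      have inV: "\<phi> \<eta> \<in> V" and in\<Omega>: "\<eta> \<in> \<Omega>" using \<eta> U V by auto
      have "((\<lambda>\<eta>. ?f (\<phi> \<eta>)) has_derivative (\<lambda>h. f' (\<phi> \<eta>) (J \<eta> h))) (at \<eta>)"
        by (rule has_derivative_compose[OF \<phi>[OF in\<Omega>] f'[OF inV]])
      then have "(data_cost l g N X Y has_derivative (\<lambda>h. f' (\<phi> \<eta>) (J \<eta> h))) (at \<eta>)"
        by (rule has_derivative_transform_within_open[OF _ U(1) \<eta>]) (simp add: data_cost_def gft)
      then show "(data_cost l g N X Y has_derivative (\<lambda>h. h \<bullet> ?Jt \<eta> (gradient ?f (\<phi> \<eta>)))) (at \<eta>)"
        by (simp add: inner_blinfun_adjoint gradf[OF inV])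
    qed
    let ?ST = "{s. 0 \<le> s \<and> ereal s < T}"
    have T: "0 < T" and \<theta>0: "\<theta> 0 = \<theta>init"
      and \<theta>: "\<And>t. \<lbrakk>0 \<le> t; ereal t < T\<rbrakk> \<Longrightarrow>
        (\<theta> has_vector_derivative - gradient (data_cost l g N X Y) (\<theta> t)) (at t within ?ST)"
      using sol unfolding maximal_ivp_solution_def ivp_solution_def by auto
    \<comment> \<open>As \<open>T\<close> may be infinite, a finite time below it is chosen; closed
      intervals then give the compactness needed for velocity bounds.\<close>
    obtain \<tau>0 where \<tau>0: "0 < \<tau>0" "ereal \<tau>0 < T"
      using ereal_dense2[OF T] by auto
    have sub: "{0..\<tau>0} \<subseteq> ?ST"
      using \<tau>0(2) by (auto intro: le_less_trans[of _ "ereal \<tau>0"])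
    have "(\<theta> \<longlongrightarrow> \<theta>init) (at 0 within ?ST)"
      using has_vector_derivative_continuous[OF \<theta>[of 0]] T \<theta>0
      by (simp add: continuous_within zero_ereal_def)
    then have "\<forall>\<^sub>F t in at 0 within ?ST. \<theta> t \<in> U"
      using topological_tendstoD[OF _ U(1,2)] by blast
    then obtain d where d: "0 < d" "\<And>t. \<lbrakk>t \<in> ?ST; t \<noteq> 0; dist t 0 < d\<rbrakk> \<Longrightarrow> \<theta> t \<in> U"
      unfolding eventually_at by blast
    define \<tau> where "\<tau> = min \<tau>0 (d / 2)"
    have \<tau>: "0 < \<tau>" "\<tau> \<le> \<tau>0" "\<tau> < d" using \<tau>0 d by (auto simp: \<tau>_def)
    have sub\<tau>: "{0..\<tau>} \<subseteq> ?ST"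
      by (rule subset_trans[OF _ sub]) (use \<tau> in auto)
    have inU: "\<theta> t \<in> U" if "t \<in> {0..\<tau>}" for t
      using d(2)[of t] that \<tau> sub\<tau> \<theta>0 U(2) by (cases "t = 0") auto
    define \<gamma>' where "\<gamma>' t = - ?Jt (\<theta> t) (gradient ?f (\<phi> (\<theta> t)))" for t
    have der: "(\<theta> has_vector_derivative \<gamma>' t) (at t within {0..\<tau>})" if t: "t \<in> {0..\<tau>}" for t
      using has_vector_derivative_within_subset[OF \<theta> sub\<tau>, of t] t sub\<tau>
      by (auto simp: \<gamma>'_def gradE[OF inU[OF t]])
    have cont: "continuous_on {0..\<tau>} \<theta>"
      using der has_vector_derivative_continuous continuous_on_eq_continuous_within by blast
    have cont\<phi>: "continuous_on {0..\<tau>} (\<lambda>t. \<phi> (\<theta> t))"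
      by (rule continuous_on_compose2[OF Ck_1_continuous_on[OF Ck_2_imp_Ck_1[OF C2]] cont])
        (use inU U in auto)
    \<comment> \<open>The velocity is written with \<open>f'\<close> in place of
      \<open>gradient\<close>, since continuity is known for \<open>f'\<close>; it supplies the
      bound \<open>C\<close>.\<close>
    have "continuous_on {0..\<tau>} (\<lambda>t. - ?Jt (\<theta> t) (blinfun_adjoint (f' (\<phi> (\<theta> t))) 1))"
    proof (intro continuous_on_minus blinfun.continuous_on continuous_on_const
        bounded_linear.continuous_on[OF bounded_linear_blinfun_adjoint])
      show "continuous_on {0..\<tau>} (\<lambda>t. J (\<theta> t))"
        by (rule continuous_on_compose2[OF Ck_1_continuous_on[OF C1J] cont]) (use inU U in auto)
      show "continuous_on {0..\<tau>} (\<lambda>t. f' (\<phi> (\<theta> t)))"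
        by (rule continuous_on_compose2[OF f'c cont\<phi>]) (use inU V in auto)
    qed
    then have "continuous_on {0..\<tau>} \<gamma>'"
      by (rule continuous_on_eq) (use inU V gradf in \<open>auto simp: \<gamma>'_def image_subset_iff\<close>)
    then have "bounded (\<gamma>' ` {0..\<tau>})"
      by (intro compact_imp_bounded compact_continuous_image) auto
    then obtain C where C: "\<And>t. t \<in> {0..\<tau>} \<Longrightarrow> norm (\<gamma>' t) \<le> C"
      unfolding bounded_iff by blast
    \<comment> \<open>The sign is moved into the argument of the adjoint, which exhibits the
      velocity as a member of its range.\<close>
    have horizontal: "\<gamma>' t \<in> range (?Jt (\<theta> t))" for t
      unfolding \<gamma>'_def blinfun.minus_right[symmetric] by blast
    have "\<exists>\<tau>'. 0 < \<tau>' \<and> \<tau>' \<le> \<tau> \<and> (\<forall>t\<in>{0..\<tau>'}. F \<theta>init (\<phi> (\<theta> t)) = \<theta> t)"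
      by (rule F[where \<gamma>' = \<gamma>' and C = C]) (use \<theta>init \<tau>(1) \<theta>0 der inU U C horizontal in auto)
    then obtain \<tau>' where \<tau>': "0 < \<tau>'" "\<tau>' \<le> \<tau>"
      and F\<theta>: "\<And>t. t \<in> {0..\<tau>'} \<Longrightarrow> F \<theta>init (\<phi> (\<theta> t)) = \<theta> t"
      by blast
    \<comment> \<open>The witness is \<open>\<tau>'\<close>, up to which
      \<open>F \<theta>init\<close> recovers the flow.\<close>
    show "\<exists>Tstar. 0 < Tstar \<and> Tstar \<le> T \<and>
             ivp_solution V (\<lambda>z. - (M z \<theta>init *v gradient ?f z)) (\<phi> \<theta>init) Tstar (\<lambda>t. \<phi> (\<theta> t))"
      unfolding ivp_solution_def
    proof (intro exI[of _ "ereal \<tau>'"] conjI allI impI; (elim conjE)?)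
      show "ereal \<tau>' \<le> T"
        using \<tau>' \<tau> \<tau>0(2) by (meson ereal_less_eq(3) less_imp_le order_trans)
      fix t assume "0 \<le> t" "ereal t < ereal \<tau>'"
      then have t: "t \<in> {0..\<tau>'}" and t': "t \<in> {0..\<tau>}" using \<tau>' by auto
      show "\<phi> (\<theta> t) \<in> V"
        using inU[OF t'] V by auto
      have in\<Omega>: "\<theta> t \<in> \<Omega>" using inU[OF t'] U by auto
      have "((\<lambda>t. \<phi> (\<theta> t)) has_vector_derivative J (\<theta> t) (\<gamma>' t)) (at t within {0..\<tau>})"
        by (rule has_vector_derivative_blinfun_compose[OF der[OF t'] \<phi>[OF in\<Omega>]])
      then have "((\<lambda>t. \<phi> (\<theta> t)) has_vector_derivative J (\<theta> t) (\<gamma>' t))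
          (at t within {s. 0 \<le> s \<and> ereal s < ereal \<tau>'})"
        by (rule has_vector_derivative_within_subset) (use \<tau>' in auto)
      \<comment> \<open>Since \<open>F \<theta>init\<close> sends \<open>\<phi> (\<theta> t)\<close>
        to \<open>\<theta> t\<close>, the matrix \<open>M\<close> is \<open>J J^T\<close> at the
        actual parameter.\<close>
      moreover have "J (\<theta> t) (\<gamma>' t) = - (M (\<phi> (\<theta> t)) \<theta>init *v gradient ?f (\<phi> (\<theta> t)))"
        by (simp add: M_def F\<theta>[OF t] matrix_vector_mul_assoc[symmetric] \<gamma>'_def blinfun.minus_right
            transpose_jacobian_apply[OF \<phi>[OF in\<Omega>]] jacobian_apply[OF \<phi>[OF in\<Omega>]]
            del: transpose_matrix_vector)
      ultimately show "((\<lambda>t. \<phi> (\<theta> t)) has_vector_derivative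
          - (M (\<phi> (\<theta> t)) \<theta>init *v gradient ?f (\<phi> (\<theta> t)))) (at t within {s. 0 \<le> s \<and> ereal s < ereal \<tau>'})"
        by simp
    qed (use \<tau>' \<theta>0 in auto)
  qed
qed

end
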